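(* Let $D\ge3$ and let $\Gamma$ be a connected combinatorial map with edges colored in $\{1,\dots,D\}$, with degree $\delta(\Gamma)=D+(D-1)E(\Gamma)-\sum_{i=1}^DF(\Gamma^{(i)})$. Then $\delta(\Gamma)\ge0$, and the first values taken by $\delta$ and the corresponding maps are: - $\delta=0$: exactly the trees. - The next value is $\delta=D-2$: exactly the maps with a single cycle ($L(\Gamma)=1$), this cycle being monochromatic. - The next value is: - if $D>4$, $\delta=D$: exactly the maps with a single cycle ($L(\Gamma)=1$), this cycle being polychromatic; - if $D=4$, $\delta=4$: exactly the maps with a single cycle which is polychromatic, the planar maps with $L(\Gamma)=2$ and two independent color-$i$ cycles ($L(\Gamma^{(i)})=2$ for some $i$), and the maps with $L(\Gamma)=2$ and one color-$i$ cycle and one color-$j$ cycle with $i\ne j$ ($L(\Gamma^{(i)})=L(\Gamma^{(j)})=1$); - if $D=3$, $\delta=2$: exactly the planar maps with $L(\Gamma)=2$ and two independent color-$i$ cycles ($L(\Gamma^{(i)})=2$ for some $i$), and the maps with $L(\Gamma)=2$ and one color-$i$ cycle and one color-$j$ cycle with $i\neq j$ ($L(\Gamma^{(i)})=L(\Gamma^{(j)})=1$).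
   Context: A combinatorial map is a finite graph (loops and multiple edges allowed) with a cyclic order of the half-edges around each vertex; here each edge carries one color in $\{1,\dots,D\}$, with no constraint on the coloring. $\Gamma^{(i)}$ is the (non-necessarily connected) map obtained by keeping all vertices of $\Gamma$ and only the edges of color $i$. $E,V,F,K$ denote numbers of edges, vertices, faces (an isolated vertex has one face; faces are summed over components) and connected components; $L=E-V+K$ is the circuit-rank; the genus is defined by $2K-2g=V-E+F$; planar means genus $0$. A cycle is monochromatic (of color $i$) if all its edges have the same color ($i$), and polychromatic if at least two of its edges have different colors. *)

theory Defs
  imports "Graph_Theory.Graph_Theory" "HOL-Combinatorics.Orbits"
begin

text \<open>
  Arcs are half-edges: an arc \<open>a\<close> is the half-edge attached to \<open>tail a\<close>, and \<open>opp\<close> exchanges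
  the two half-edges of an edge, so an edge is a pair \<open>{a, opp a}\<close>; loops and multiple edges are
  allowed. \<open>rot\<close> gives the next half-edge around the same vertex.
\<close>

record ('v, 'h) cmap =
  skel :: "('v, 'h) pre_digraph"
  opp :: "'h \<Rightarrow> 'h"
  rot :: "'h \<Rightarrow> 'h"
  colour :: "'h \<Rightarrow> nat"

locale coloured_map =
  fin_digraph "skel M" + bidirected_digraph "skel M" "opp M"
  for D :: nat and M :: "('v, 'h) cmap" +
  assumes rot_permutes: "rot M permutes arcs (skel M)"
    and rot_cyclic: "v \<in> verts (skel M) \<Longrightarrow> out_arcs (skel M) v \<noteq> {} \<Longrightarrow>
                       cyclic_on (rot M) (out_arcs (skel M) v)"
    and colour_range: "a \<in> arcs (skel M) \<Longrightarrow> colour M a \<in> {1..D}"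
    and colour_opp: "a \<in> arcs (skel M) \<Longrightarrow> colour M (opp M a) = colour M a"

text \<open>\<open>connected\<close> excludes the empty graph.\<close>

definition connected_coloured_map :: "nat \<Rightarrow> ('v, 'h) cmap \<Rightarrow> bool" where
  "connected_coloured_map D M \<longleftrightarrow> coloured_map D M \<and> Digraph_Component.connected (skel M)"

definition first_return :: "('h \<Rightarrow> 'h) \<Rightarrow> 'h set \<Rightarrow> 'h \<Rightarrow> 'h" where
  "first_return f H x =
     (if x \<in> H then (f ^^ (LEAST n. 0 < n \<and> (f ^^ n) x \<in> H)) x else x)"

text \<open>
  The cyclic orders of the submap are the induced ones: skip the half-edges of other colours.
\<close>

definition colour_submap :: "('v, 'h) cmap \<Rightarrow> nat \<Rightarrow> ('v, 'h) cmap" where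
  "colour_submap M i =
     (let H = {a \<in> arcs (skel M). colour M a = i} in
      M\<lparr>skel := (skel M)\<lparr>arcs := H\<rparr>,
        opp := perm_restrict (opp M) H,
        rot := first_return (rot M) H\<rparr>)"

definition edge_of :: "('v, 'h) cmap \<Rightarrow> 'h \<Rightarrow> 'h set" where
  "edge_of M a = {a, opp M a}"

definition num_verts :: "('v, 'h) cmap \<Rightarrow> nat" where
  "num_verts M = card (verts (skel M))"

definition num_edges :: "('v, 'h) cmap \<Rightarrow> nat" where
  "num_edges M = card (edge_of M ` arcs (skel M))"

text \<open>
  Faces are the orbits of \<open>rot \<circ> opp\<close> on half-edges, plus one face for each isolated vertex.
\<close>

definition num_faces :: "('v, 'h) cmap \<Rightarrow> nat" where
  "num_faces M = card (orbit (rot M \<circ> opp M) ` arcs (skel M))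
               + card {v \<in> verts (skel M). out_arcs (skel M) v = {}}"

text \<open>
  The digraph is symmetric, so its strongly connected components are its connected components.
\<close>

definition num_comps :: "('v, 'h) cmap \<Rightarrow> nat" where
  "num_comps M = card (pre_digraph.sccs_verts (skel M))"

definition circuit_rank :: "('v, 'h) cmap \<Rightarrow> int" where
  "circuit_rank M = int (num_edges M) - int (num_verts M) + int (num_comps M)"

text \<open>
  The solution \<open>g\<close> of \<open>2K - 2g = V - E + F\<close>, real-valued so that no rounding is involved.
\<close>

definition genus :: "('v, 'h) cmap \<Rightarrow> real" where
  "genus M = (2 * real (num_comps M) - real (num_verts M) + real (num_edges M)
              - real (num_faces M)) / 2"

definition planar_map :: "('v, 'h) cmap \<Rightarrow> bool" where
  "planar_map M \<longleftrightarrow> genus M = 0"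

text \<open>
  A cycle is represented by its set of edges. In a symmetric digraph, \<open>a, opp a\<close> is a directed
  cycle; requiring that no edge be traversed in both directions leaves exactly the cycles of the
  undirected multigraph (including loops and pairs of parallel edges). For the same reason the
  library predicates \<open>forest\<close> and \<open>tree\<close> are not usable here.
\<close>

definition cycles :: "('v, 'h) cmap \<Rightarrow> 'h set set set" where
  "cycles M = {edge_of M ` set p | p.
     pre_digraph.cycle (skel M) p \<and> (\<forall>a \<in> set p. opp M a \<notin> set p)}"

definition is_tree :: "('v, 'h) cmap \<Rightarrow> bool" where
  "is_tree M \<longleftrightarrow> Digraph_Component.connected (skel M) \<and> cycles M = {}"

definition monochromatic :: "('v, 'h) cmap \<Rightarrow> 'h set set \<Rightarrow> bool" where
  "monochromatic M C \<longleftrightarrow> (\<exists>i. \<forall>e \<in> C. \<forall>a \<in> e. colour M a = i)"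

definition polychromatic :: "('v, 'h) cmap \<Rightarrow> 'h set set \<Rightarrow> bool" where
  "polychromatic M C \<longleftrightarrow>
     (\<exists>e \<in> C. \<exists>f \<in> C. \<exists>a \<in> e. \<exists>b \<in> f. colour M a \<noteq> colour M b)"

definition map_degree :: "nat \<Rightarrow> ('v, 'h) cmap \<Rightarrow> int" where
  "map_degree D M = int D + (int D - 1) * int (num_edges M)
                    - (\<Sum>i = 1..D. int (num_faces (colour_submap M i)))"

end

theory Submission
  imports Defs
begin

text \<open>
  Restrict the map to a set \<open>H\<close> of edges and delete edges one at a time. Deleting an edge changes
  the number of faces by one, since it composes the face permutation with a transposition, and the
  number of components by one exactly when the edge lies on no cycle; in that case the number of
  faces must increase. Hence the genus is nonnegative, it is unchanged as long as the circuit rank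
  is, and the circuit ranks \<open>L\<^sub>i\<close> of the colour submaps satisfy \<open>\<Sum> L\<^sub>i \<le> L\<close>. Eliminating the face
  numbers from the degree gives
  \<open>\<delta> = D L - 2 \<Sum> L\<^sub>i + 2 \<Sum> g\<^sub>i = (D - 2) L + 2 (L - \<Sum> L\<^sub>i) + 2 \<Sum> g\<^sub>i\<close>, and \<open>2 g\<^sub>i \<le> L\<^sub>i\<close>,
  so only \<open>L \<le> 2\<close> is relevant for the first values.
\<close>

subsection \<open>Orbits\<close>

text \<open>Two facts control the genus terms. Twice the genus equals L + K - F, and every component
  carries a face; this gives the bound by L. Twice the genus is also even, so rank at most 1 forces
  genus 0. Hence no genus term survives for L \<le> 1, and planarity matters only when a single
  colour has rank 2. Then this colour submap and the whole map have the same rank, hence the same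
  genus, which turns a condition on the submap into planarity of the whole map. The split at D = 3
  and D = 4 comes from comparing 2 D - 4, the least degree possible for L = 2, with the degree D of
  a map whose single cycle is polychromatic: smaller for D = 3, equal for D = 4, larger for D > 4.
  For L \<ge> 3 the degree is at least 3 (D - 2), which exceeds the third value in every case. That
  the listed numbers are really attained needs examples: bouquets of loops of distinct colours, and
  a cycle of two edges of different colours.\<close>

lemma card_image_merge:
  fixes c c' :: "'a \<Rightarrow> 'a set"
  assumes "finite V" "u \<in> V" "v \<in> V" "v \<notin> c' u"
    and self: "\<And>x. x \<in> V \<Longrightarrow> x \<in> c' x"
    and eq: "\<And>x y. x \<in> V \<Longrightarrow> y \<in> c' x \<Longrightarrow> c' y = c' x"
    and merge: "\<And>x. x \<in> V \<Longrightarrow> c x = (if x \<in> c' u \<union> c' v then c' u \<union> c' v else c' x)"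
  shows "card (c' ` V) = card (c ` V) + 1"
proof -
  let ?R = "c' ` {x \<in> V. x \<notin> c' u \<union> c' v}"
  have 1: "c' ` V = insert (c' u) (insert (c' v) ?R)"
  proof -
    have "c' x \<in> {c' u, c' v}" if "x \<in> c' u \<union> c' v" for x
    proof (cases "x \<in> c' u")
      case True then show ?thesis using eq[OF assms(2) True] by blast
    next
      case False
      then have "x \<in> c' v" using that by blast
      then show ?thesis using eq[OF assms(3)] by blast
    qed
    then show ?thesis using assms(2,3) by blast
  qed
  have 2: "c ` V = insert (c' u \<union> c' v) ?R"
  proof -
    have "c ` V = c ` (V \<inter> (c' u \<union> c' v)) \<union> c ` {x \<in> V. x \<notin> c' u \<union> c' v}" by blast
    moreover have "c ` {x \<in> V. x \<notin> c' u \<union> c' v} = ?R" using merge by (intro image_cong) auto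
    moreover have "c ` (V \<inter> (c' u \<union> c' v)) = (\<lambda>x. c' u \<union> c' v) ` (V \<inter> (c' u \<union> c' v))"
      using merge by (intro image_cong) auto
    moreover have "u \<in> V \<inter> (c' u \<union> c' v)" using assms(2) self by blast
    ultimately show ?thesis by auto
  qed
  have "c' u \<noteq> c' v" using assms(3,4) self by blast
  moreover have "c' x \<noteq> X" if "x \<in> V" "x \<notin> c' u \<union> c' v" "X \<in> {c' u, c' v, c' u \<union> c' v}" for x X
    using self[OF that(1)] that(2,3) by blast
  then have "c' u \<notin> ?R" "c' v \<notin> ?R" "c' u \<union> c' v \<notin> ?R" by blast+
  ultimately show ?thesis
    unfolding 1 2 using assms(1) by simp
qed

text \<open>The composed map sends \<open>b\<close> to \<open>f a\<close> and then follows
  \<open>f\<close> until it comes back to \<open>b\<close>. So the orbit of \<open>b\<close> closes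
  up inside the stretch of the \<open>f\<close>-orbit from \<open>f a\<close> to the first visit of
  \<open>b\<close>, and this stretch misses \<open>a\<close>.\<close>

lemma orbit_comp_transpose_split:
  assumes "a \<noteq> b" "b \<in> orbit f a"
  shows "b \<notin> orbit (f \<circ> transpose a b) a \<or> a \<notin> orbit (f \<circ> transpose a b) b"
proof -
  define n where "n = (LEAST n. 0 < n \<and> (f ^^ n) a = b)"
  have ex: "\<exists>n. 0 < n \<and> (f ^^ n) a = b" using assms(2) by (auto simp: orbit_altdef)
  have n: "0 < n" "(f ^^ n) a = b" using LeastI_ex[OF ex] unfolding n_def by auto
  have least: "n \<le> m" if "0 < m" "(f ^^ m) a = b" for m
    unfolding n_def using that by (intro Least_le) auto
  define S where "S = (\<lambda>k. (f ^^ k) a) ` {1..n}"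
  \<comment> \<open>A return to \<open>a\<close> after \<open>k\<close> steps would make
    \<open>n - k\<close> a smaller number of steps from \<open>a\<close> to
    \<open>b\<close>.\<close>
  have "a \<notin> S"
  proof
    assume "a \<in> S"
    then obtain k where k: "1 \<le> k" "k \<le> n" "(f ^^ k) a = a" by (auto simp: S_def)
    have "k \<noteq> n" using k n assms(1) by auto
    moreover have "(f ^^ (n - k)) a = b"
      using n(2) k funpow_add[of "n - k" k f] by simp
    ultimately show False using least[of "n - k"] k by simp
  qed
  have step: "f x \<in> S" if "x \<in> S" "x \<noteq> b" for x
  proof -
    obtain k where k: "1 \<le> k" "k \<le> n" "x = (f ^^ k) a" using \<open>x \<in> S\<close> by (auto simp: S_def)
    with n(2) that(2) have "k \<noteq> n" by auto
    then show ?thesis using k unfolding S_def by (intro image_eqI[of _ _ "Suc k"]) auto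
  qed
  have fa: "f a \<in> S" using n(1) unfolding S_def by (intro image_eqI[of _ _ 1]) auto
  have "x \<in> S" if "x \<in> orbit (f \<circ> transpose a b) b" for x
    using that
  proof induction
    case base then show ?case using fa by simp
  next
    case (step y)
    then show ?case using \<open>a \<notin> S\<close> fa \<open>\<And>x. x \<in> S \<Longrightarrow> x \<noteq> b \<Longrightarrow> f x \<in> S\<close>
      by (cases "y = b") (auto simp: transpose_def)
  qed
  then show ?thesis using \<open>a \<notin> S\<close> by blast
qed

lemma orbit_eqI_permutation:
  assumes "permutation f" "y \<in> orbit f x"
  shows "orbit f y = orbit f x"
  using assms by (meson cyclic_on_orbit' orbit_cyclic_eq3)

text \<open>The composed map differs from \<open>f\<close> only in that \<open>a\<close> and
  \<open>b\<close> exchange their successors. With \<open>a\<close> and \<open>b\<close> on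
  different cycles, it runs through one cycle, leaves it for the other, and returns: the two cycles
  are joined and all others are untouched.\<close>

lemma orbit_comp_transpose_merge:
  assumes f: "permutation f" and "b \<notin> orbit f a"
  shows "orbit (f \<circ> transpose a b) x =
    (if x \<in> orbit f a \<union> orbit f b then orbit f a \<union> orbit f b else orbit f x)"
proof -
  let ?g = "f \<circ> transpose a b"
  have g: "permutation ?g"
    using f by (simp add: permutation_compose permutation_swap_id)
  have self: "x \<in> orbit f x" "x \<in> orbit ?g x" for x
    using f g by (auto intro: permutation_self_in_orbit)
  have "a \<noteq> b" using assms(2) self by auto
  have geq: "?g y = f y" if "y \<noteq> a" "y \<noteq> b" for y using that by (simp add: transpose_def)
  have same: "orbit ?g x = orbit f x" if "a \<notin> orbit f x" "b \<notin> orbit f x" for x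
    by (rule orbit_cong[OF self(1)]) (metis geq that)
  have fwd: "orbit ?g x \<subseteq> orbit f a \<union> orbit f b" if "x \<in> orbit f a \<union> orbit f b" for x
  proof
    have cl: "?g y \<in> orbit f a \<union> orbit f b" if "y \<in> orbit f a \<union> orbit f b" for y
      using that by (cases "y = a \<or> y = b") (auto simp: geq intro: orbit.intros)
    fix y assume "y \<in> orbit ?g x"
    then show "y \<in> orbit f a \<union> orbit f b" by induction (use that cl in blast)+
  qed
  \<comment> \<open>Starting at \<open>d\<close>, the composed map enters the \<open>f\<close>-cycle
    of \<open>c\<close> at \<open>f c\<close> and follows \<open>f\<close> there. The only place
    where it would depart is \<open>c\<close> itself, but the next point of the
    \<open>f\<close>-cycle is then again \<open>f c = ?g d\<close>, already reached.\<close>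
  have sub: "orbit f c \<subseteq> orbit ?g d" 
    if "{c, d} = {a, b}" for c d
  proof
    have cd: "c \<noteq> d" "d \<notin> orbit f c" "?g d = f c"
      using that \<open>a \<noteq> b\<close> assms(2) f self(1)
      by (auto simp: doubleton_eq_iff) (metis orbit_eqI_permutation)
    fix y assume "y \<in> orbit f c"
    then obtain n where n: "0 < n" "y = (f ^^ n) c" by (auto simp: orbit_altdef)
    have "(f ^^ Suc k) c \<in> orbit ?g d" for k
    proof (induction k)
      case 0 then show ?case using cd(3) orbit.base[of ?g d] by (simp del: o_apply)
    next
      case (Suc k)
      show ?case
      proof (cases "(f ^^ Suc k) c = c")
        case True
        then have "(f ^^ Suc (Suc k)) c = ?g d" using cd(3) by simp
        then show ?thesis by (metis orbit.base)
      next
        case False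
        moreover have "(f ^^ Suc k) c \<noteq> d"
          using cd(2) unfolding orbit_altdef by blast
        ultimately have "?g ((f ^^ Suc k) c) = (f ^^ Suc (Suc k)) c"
          using that by (auto simp: doubleton_eq_iff geq)
        then show ?thesis using Suc by (metis orbit.step)
      qed
    qed
    then show "y \<in> orbit ?g d" using n by (metis gr0_implies_Suc)
  qed
  have "a \<in> orbit ?g b" using sub[of a b] self by blast
  then have "orbit ?g a = orbit ?g b" using g orbit_eqI_permutation by metis
  then have ab: "orbit f a \<union> orbit f b \<subseteq> orbit ?g a"
    using sub[of a b] sub[of b a] by (auto simp: insert_commute)
  show ?thesis
  proof (cases "x \<in> orbit f a \<union> orbit f b")
    case True
    then have "orbit ?g x = orbit ?g a" using ab by (intro orbit_eqI_permutation[OF g]) blast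
    moreover have "orbit f a \<union> orbit f b = orbit ?g x"
      using ab fwd[OF True] calculation by (intro subset_antisym) simp_all
    ultimately show ?thesis using True by (simp only: if_True)
  next
    case False
    then have "a \<notin> orbit f x" "b \<notin> orbit f x"
      using orbit_eqI_permutation[OF f] self(1)[of x] by (metis UnI1, metis UnI2)
    then show ?thesis using same False by simp
  qed
qed

lemma card_orbits_comp_transpose_merge:
  assumes "f permutes A" "finite A" "a \<in> A" "b \<in> A" "b \<notin> orbit f a"
  shows "card (orbit f ` A) = card (orbit (f \<circ> transpose a b) ` A) + 1"
proof (rule card_image_merge[where u = a and v = b])
  have f: "permutation f" using assms permutation_permutes by blast
  show "x \<in> orbit f x" for x using f by (rule permutation_self_in_orbit)
  show "orbit f y = orbit f x" if "y \<in> orbit f x" for x y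
    using f that by (rule orbit_eqI_permutation)
  show "orbit (f \<circ> transpose a b) x =
    (if x \<in> orbit f a \<union> orbit f b then orbit f a \<union> orbit f b else orbit f x)" for x
    using f assms(5) by (rule orbit_comp_transpose_merge)
qed (use assms in auto)

text \<open>The transposition is an involution, so the merging count applies in both directions. The
  case distinction refers to the composed permutation because that one will be the face permutation
  after a deletion: a common orbit there yields a connection that avoids the deleted edge.\<close>

lemma card_orbits_comp_transpose:
  assumes f: "f permutes A" and fin: "finite A" and ab: "a \<in> A" "b \<in> A" "a \<noteq> b"
  shows "if b \<in> orbit (f \<circ> transpose a b) a
    then card (orbit f ` A) = card (orbit (f \<circ> transpose a b) ` A) + 1
    else card (orbit (f \<circ> transpose a b) ` A) = card (orbit f ` A) + 1"
proof -
  let ?g = "f \<circ> transpose a b"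
  have g: "?g permutes A" using f ab by (intro permutes_compose permutes_swap_id)
  have gg: "?g \<circ> transpose a b = f" by (simp add: fun_eq_iff)
  have p: "permutation f" "permutation ?g" using f g fin permutation_permutes by blast+
  have "b \<notin> orbit f a" if "b \<in> orbit ?g a"
  proof
    assume "b \<in> orbit f a"
    then have "b \<notin> orbit ?g a \<or> a \<notin> orbit ?g b" by (rule orbit_comp_transpose_split[OF ab(3)])
    then show False using that p(2) by (metis orbit_eqI_permutation permutation_self_in_orbit)
  qed
  then show ?thesis
    using card_orbits_comp_transpose_merge[OF f fin ab(1,2)]
      card_orbits_comp_transpose_merge[OF g fin ab(1,2)] unfolding gg by auto
qed

section \<open>First-return maps, and two facts on finite sums and images\<close>

lemma first_return_steps:
  assumes "x \<in> H" "(f ^^ m) x \<in> H" "0 < m"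
  obtains n where "0 < n" "n \<le> m" "first_return f H x = (f ^^ n) x" "(f ^^ n) x \<in> H"
    "\<And>k. 0 < k \<Longrightarrow> k < n \<Longrightarrow> (f ^^ k) x \<notin> H"
proof
  let ?n = "LEAST n. 0 < n \<and> (f ^^ n) x \<in> H"
  have "0 < ?n \<and> (f ^^ ?n) x \<in> H" using assms by (intro LeastI) auto
  then show "0 < ?n" "(f ^^ ?n) x \<in> H" by auto
  show "?n \<le> m" using assms by (intro Least_le) auto
  show "first_return f H x = (f ^^ ?n) x" using assms by (simp add: first_return_def)
  show "(f ^^ k) x \<notin> H" if "0 < k" "k < ?n" for k
    using not_less_Least[OF that(2)] that(1) by blast
qed

lemma first_return_eqI:
  assumes "x \<in> H" "0 < n" "(f ^^ n) x \<in> H"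
    and "\<And>k. 0 < k \<Longrightarrow> k < n \<Longrightarrow> (f ^^ k) x \<notin> H"
  shows "first_return f H x = (f ^^ n) x"
proof -
  obtain m where m: "0 < m" "m \<le> n" "first_return f H x = (f ^^ m) x" "(f ^^ m) x \<in> H"
    using first_return_steps[OF assms(1,3,2)] by blast
  then have "m = n" using assms(4)[of m] by fastforce
  then show ?thesis using m(3) by simp
qed

text \<open>Strong induction on the number of \<open>f\<close>-steps from \<open>x\<close> to
  \<open>y\<close>: the first return to \<open>H\<close> occurs no later than \<open>y\<close>, so
  one step of the first-return map can be split off.\<close>

lemma orbit_first_return:
  assumes f: "permutation f" and "x \<in> H"
  shows "orbit (first_return f H) x = orbit f x \<inter> H"
proof (intro set_eqI iffI)
  have ret: "first_return f H y \<in> orbit f y \<inter> H" if "y \<in> H" for y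
  proof -
    have "y \<in> orbit f y" using f by (rule permutation_self_in_orbit)
    then obtain m where m: "0 < m" "y = (f ^^ m) y"
      unfolding orbit_altdef by blast
    have "(f ^^ m) y \<in> H" using that m(2)[symmetric] by simp
    from that this m(1) obtain n where "0 < n" "first_return f H y = (f ^^ n) y" "(f ^^ n) y \<in> H"
      by (metis first_return_steps)
    then show ?thesis by (auto simp: orbit_altdef)
  qed
  fix y
  {
    assume "y \<in> orbit (first_return f H) x"
    then show "y \<in> orbit f x \<inter> H"
      by induction (use ret assms(2) orbit_trans in fast)+
  next
    assume "y \<in> orbit f x \<inter> H"
    then obtain m where m: "0 < m" "y = (f ^^ m) x" "y \<in> H" by (auto simp: orbit_altdef)
    then show "y \<in> orbit (first_return f H) x"
      using assms(2)
    proof (induction m arbitrary: x rule: less_induct)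
      case (less m)
      then obtain n where n: "0 < n" "n \<le> m" "first_return f H x = (f ^^ n) x" "(f ^^ n) x \<in> H"
        by (metis first_return_steps)
      show ?case
      proof (cases "n = m")
        case True then show ?thesis using n(3) less.prems(2) orbit.base by metis
      next
        case False
        have "y = (f ^^ (m - n)) ((f ^^ n) x)"
          using less.prems(2) n(2) funpow_add[of "m - n" n f] by simp
        then have "y \<in> orbit (first_return f H) ((f ^^ n) x)"
          using less.IH[of "m - n" "(f ^^ n) x"] n(1,2,4) False less.prems(3) by simp
        then show ?thesis using n(3) by (metis orbit_subset)
      qed
    qed
  }
qed

lemma card_image_le_factor:
  assumes "finite A" "\<And>x y. x \<in> A \<Longrightarrow> y \<in> A \<Longrightarrow> f x = f y \<Longrightarrow> g x = g y"
  shows "card (g ` A) \<le> card (f ` A)"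
proof -
  have "g ` A = (g \<circ> inv_into A f) ` f ` A"
    unfolding image_image o_apply
    by (intro image_cong refl assms(2)) (simp_all add: inv_into_into f_inv_into_f)
  then show ?thesis using assms(1) card_image_le by (metis finite_imageI)
qed

text \<open>The partitions 2 = 2 and 2 = 1 + 1 are the source of the two families of maps with
  \<open>L = 2\<close>.\<close>

lemma sum_nonneg_eq_2_cases:
  fixes r :: "'a \<Rightarrow> int"
  assumes "finite I" "\<And>i. i \<in> I \<Longrightarrow> 0 \<le> r i" "sum r I = 2"
  obtains (one) i where "i \<in> I" "r i = 2"
  | (two) i j where "i \<in> I" "j \<in> I" "i \<noteq> j" "r i = 1" "r j = 1"
proof -
  have "\<exists>i \<in> I. r i \<noteq> 0" using assms(3) by (metis sum.neutral zero_neq_numeral)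
  then obtain i where i: "i \<in> I" "r i \<noteq> 0" by blast
  have rest: "sum r I = r i + sum r (I - {i})" by (rule sum.remove[OF assms(1) i(1)])
  have "0 \<le> sum r (I - {i})" using assms(2) by (intro sum_nonneg) auto
  then consider "r i = 2" | "r i = 1" "sum r (I - {i}) = 1"
    using rest i assms(2)[OF i(1)] assms(3) by linarith
  then show ?thesis
  proof cases
    case 1 then show ?thesis using one i(1) by blast
  next
    case 2
    then have "\<exists>j \<in> I - {i}. r j \<noteq> 0" by (metis sum.neutral zero_neq_one)
    then obtain j where j: "j \<in> I - {i}" "r j \<noteq> 0" by blast
    have "sum r (I - {i}) = r j + sum r (I - {i} - {j})"
      using assms(1) j(1) by (intro sum.remove) auto
    moreover have "0 \<le> sum r (I - {i} - {j})" using assms(2) by (intro sum_nonneg) auto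
    ultimately have "r j = 1" using 2(2) j assms(2)[of j] by auto
    then show ?thesis using two[of i j] i(1) j(1) 2(1) by blast
  qed
qed

context coloured_map
begin

subsection \<open>Edge deletion\<close>

text \<open>Encodes a set of edges by its half-edges. Closure under the involution makes
  \<open>ends\<close> symmetric, so that one-way reachability already is connectedness.\<close>

definition opp_closed :: "'h set \<Rightarrow> bool" where
  "opp_closed H \<longleftrightarrow> H \<subseteq> arcs (skel M) \<and> (\<forall>a \<in> H. opp M a \<in> H)"

definition ends :: "'h set \<Rightarrow> ('v \<times> 'v) set" where
  "ends H = (\<lambda>a. (tail (skel M) a, head (skel M) a)) ` H"

definition comp_of :: "'h set \<Rightarrow> 'v \<Rightarrow> 'v set" where
  "comp_of H v = (ends H)\<^sup>* `` {v}"

definition comps :: "'h set \<Rightarrow> nat" where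
  "comps H = card (comp_of H ` verts (skel M))"

text \<open>
  Extending the involution by the identity lets all submaps act on the same set of half-edges:
  a face of the submap is an orbit meeting \<open>H\<close>, and an orbit disjoint from \<open>H\<close> is a vertex
  that has become isolated.
\<close>

definition face_perm :: "'h set \<Rightarrow> 'h \<Rightarrow> 'h" where
  "face_perm H = rot M \<circ> perm_restrict (opp M) H"

text \<open>The second summand does not depend on \<open>H\<close>: only vertices without half-edges
  in the whole map are missed by the orbits.\<close>

definition faces :: "'h set \<Rightarrow> nat" where
  "faces H = card (orbit (face_perm H) ` arcs (skel M))
           + card {v \<in> verts (skel M). out_arcs (skel M) v = {}}"

definition edges :: "'h set \<Rightarrow> nat" where
  "edges H = card (edge_of M ` H)"

definition rank :: "'h set \<Rightarrow> int" where
  "rank H = int (edges H) - int (card (verts (skel M))) + int (comps H)"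

text \<open>The doubled genus stays in the integers, where parity arguments are available.\<close>

definition double_genus :: "'h set \<Rightarrow> int" where
  "double_genus H = 2 * int (comps H) - int (card (verts (skel M))) + int (edges H) - int (faces H)"

lemma opp_closedD:
  assumes "opp_closed H" "a \<in> H"
  shows "a \<in> arcs (skel M)" "opp M a \<in> H"
  using assms by (auto simp: opp_closed_def)

lemma finite_opp_closed: "opp_closed H \<Longrightarrow> finite H"
  using finite_subset[OF _ finite_arcs] by (auto simp: opp_closed_def)

lemma opp_closed_arcs: "opp_closed (arcs (skel M))"
  by (simp add: opp_closed_def)

lemma opp_closed_Int_colour:
  "opp_closed H \<Longrightarrow> opp_closed {a \<in> H. colour M a = i}"
  by (auto simp: opp_closed_def colour_opp subset_iff)

lemma opp_closed_delete: "opp_closed H \<Longrightarrow> opp_closed (H - {a, opp M a})"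
  by (auto simp: opp_closed_def) (metis arev_arev)

lemma opp_closed_induct [consumes 1, case_names empty delete]:
  assumes "opp_closed H" "P {}"
    and "\<And>H a. opp_closed H \<Longrightarrow> a \<in> H \<Longrightarrow> P (H - {a, opp M a}) \<Longrightarrow> P H"
  shows "P H"
  using finite_opp_closed[OF assms(1)] assms(1)
proof (induction rule: finite_psubset_induct)
  case (psubset H)
  show ?case
  proof (cases "H = {}")
    case False
    then obtain a where "a \<in> H" by blast
    then show ?thesis
      using assms(3)[OF psubset.prems] psubset.IH[OF _ opp_closed_delete[OF psubset.prems]] by blast
  qed (use assms(2) in simp)
qed

lemma ends_sym: "opp_closed H \<Longrightarrow> sym (ends H)"
  by (rule symI) (force simp: ends_def opp_closed_def intro: rev_image_eqI)

lemma comp_of_self: "v \<in> comp_of H v"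
  by (simp add: comp_of_def)

lemma comp_of_sym: "opp_closed H \<Longrightarrow> w \<in> comp_of H v \<Longrightarrow> v \<in> comp_of H w"
  using symD[OF sym_rtrancl[OF ends_sym], of H v w] by (simp add: comp_of_def)

lemma comp_of_trans: "w \<in> comp_of H v \<Longrightarrow> x \<in> comp_of H w \<Longrightarrow> x \<in> comp_of H v"
  unfolding comp_of_def by auto

lemma comp_of_eq: "opp_closed H \<Longrightarrow> w \<in> comp_of H v \<Longrightarrow> comp_of H w = comp_of H v"
  by (intro subset_antisym subsetI) (metis comp_of_sym comp_of_trans)+

lemma comp_of_mono: "H \<subseteq> H' \<Longrightarrow> comp_of H v \<subseteq> comp_of H' v"
proof -
  assume "H \<subseteq> H'"
  then have "(ends H)\<^sup>* \<subseteq> (ends H')\<^sup>*" unfolding ends_def by (intro rtrancl_mono image_mono)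
  then show ?thesis unfolding comp_of_def by blast
qed

lemma comp_of_least:
  assumes "v \<in> X" "\<And>a. a \<in> H \<Longrightarrow> tail (skel M) a \<in> X \<Longrightarrow> head (skel M) a \<in> X"
  shows "comp_of H v \<subseteq> X"
proof
  fix w assume "w \<in> comp_of H v"
  then have "(v, w) \<in> (ends H)\<^sup>*" by (simp add: comp_of_def)
  then show "w \<in> X" by induction (use assms in \<open>auto simp: ends_def\<close>)
qed

lemma head_in_comp_of:
  assumes "a \<in> H" "tail (skel M) a \<in> comp_of H v"
  shows "head (skel M) a \<in> comp_of H v"
  using assms unfolding comp_of_def ends_def by (auto intro: rtrancl_into_rtrancl)

text \<open>Every half-edge of \<open>H\<close> lies in \<open>H'\<close> or joins \<open>u\<close>
  and \<open>v\<close>. Adding the edge back therefore either changes no class or unites exactly the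
  classes of \<open>u\<close> and \<open>v\<close>.\<close>

lemma comp_of_delete:
  assumes H: "opp_closed H" "a \<in> H"
  defines "H' \<equiv> H - {a, opp M a}" and "u \<equiv> tail (skel M) a" and "v \<equiv> head (skel M) a"
  shows "v \<in> comp_of H' u \<Longrightarrow> comp_of H x = comp_of H' x"
    and "v \<notin> comp_of H' u \<Longrightarrow> comp_of H x =
      (if x \<in> comp_of H' u \<union> comp_of H' v then comp_of H' u \<union> comp_of H' v else comp_of H' x)"
proof -
  have H': "opp_closed H'" unfolding H'_def by (rule opp_closed_delete[OF H(1)])
  have sub: "comp_of H' x \<subseteq> comp_of H x" for x by (rule comp_of_mono) (auto simp: H'_def)
  have aA: "a \<in> arcs (skel M)" using opp_closedD[OF H] by simp
  have arc: "c \<in> H' \<or> (tail (skel M) c = u \<and> head (skel M) c = v) \<or>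
    (tail (skel M) c = v \<and> head (skel M) c = u)" if "c \<in> H" for c
    using that aA by (auto simp: H'_def u_def v_def)
  have uv: "comp_of H u = comp_of H v"
    by (rule comp_of_eq[OF H(1), symmetric])
      (use head_in_comp_of[OF H(2), of u] comp_of_self in \<open>simp add: u_def v_def\<close>)
  {
    assume v: "v \<in> comp_of H' u"
    then have u: "u \<in> comp_of H' v" by (rule comp_of_sym[OF H'])
    have "comp_of H x \<subseteq> comp_of H' x"
      by (rule comp_of_least[OF comp_of_self]) (metis arc head_in_comp_of comp_of_trans u v)
    then show "comp_of H x = comp_of H' x" using sub by blast
  next
    assume v: "v \<notin> comp_of H' u"
    let ?X = "comp_of H' u \<union> comp_of H' v"
    have X: "comp_of H x = ?X" if "x \<in> ?X"
    proof
      show "comp_of H x \<subseteq> ?X"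
        by (rule comp_of_least[OF that]) (metis Un_iff arc head_in_comp_of comp_of_self)
      have "x \<in> comp_of H u \<union> comp_of H v" using that sub by blast
      then have "comp_of H x = comp_of H u" using comp_of_eq[OF H(1)] uv by (metis Un_absorb)
      then show "?X \<subseteq> comp_of H x" using sub[of u] sub[of v] uv by simp
    qed
    have "comp_of H x \<subseteq> comp_of H' x" if "x \<notin> ?X"
      by (rule comp_of_least[OF comp_of_self])
        (metis Un_iff arc head_in_comp_of comp_of_sym[OF H'] that)
    then show "comp_of H x = (if x \<in> ?X then ?X else comp_of H' x)"
      using X sub[of x] by (metis subset_antisym)
  }
qed

text \<open>Uniting two vertex classes has the same shape as joining two cycles of a permutation, so
  \<open>card_image_merge\<close> does both counts.\<close>

lemma comps_delete:
  assumes H: "opp_closed H" "a \<in> H"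
  defines "H' \<equiv> H - {a, opp M a}"
  shows "comps H' = comps H + (if head (skel M) a \<in> comp_of H' (tail (skel M) a) then 0 else 1)"
proof (cases "head (skel M) a \<in> comp_of H' (tail (skel M) a)")
  case True
  then show ?thesis unfolding comps_def H'_def by (simp add: comp_of_delete(1)[OF H])
next
  case False
  have H': "opp_closed H'" unfolding H'_def by (rule opp_closed_delete[OF H(1)])
  have "a \<in> arcs (skel M)" using opp_closedD[OF H] by simp
  then have "card (comp_of H' ` verts (skel M)) = card (comp_of H ` verts (skel M)) + 1"
    using False finite_verts comp_of_self comp_of_eq[OF H'] comp_of_delete(2)[OF H]
    unfolding H'_def by (intro card_image_merge) auto
  then show ?thesis using False by (simp add: comps_def)
qed

lemma edges_delete:
  assumes H: "opp_closed H" "a \<in> H"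
  shows "edges H = edges (H - {a, opp M a}) + 1"
proof -
  have aA: "a \<in> arcs (skel M)" using opp_closedD[OF H] by simp
  have "edge_of M ` H = insert (edge_of M a) (edge_of M ` (H - {a, opp M a}))"
    using H by (auto simp: edge_of_def opp_closed_def)
  moreover have "edge_of M a \<notin> edge_of M ` (H - {a, opp M a})"
    by (auto simp: edge_of_def)
  ultimately show ?thesis
    unfolding edges_def using finite_opp_closed[OF H(1)] by simp
qed

lemma tail_rot:
  assumes "a \<in> arcs (skel M)"
  shows "tail (skel M) (rot M a) = tail (skel M) a"
proof -
  have "a \<in> out_arcs (skel M) (tail (skel M) a)" using assms by simp
  then have "rot M a \<in> out_arcs (skel M) (tail (skel M) a)"
    using rot_cyclic assms by (metis cyclic_on_inI empty_iff tail_in_verts)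
  then show ?thesis by simp
qed

lemma orbit_rot:
  assumes "a \<in> arcs (skel M)"
  shows "orbit (rot M) a = out_arcs (skel M) (tail (skel M) a)"
proof (rule orbit_cyclic_eq3[OF rot_cyclic])
  show a: "a \<in> out_arcs (skel M) (tail (skel M) a)" using assms by simp
  then show "out_arcs (skel M) (tail (skel M) a) \<noteq> {}" by blast
qed (use assms in simp)

lemma perm_restrict_opp_permutes:
  assumes "opp_closed H"
  shows "perm_restrict (opp M) H permutes arcs (skel M)"
proof (rule bij_imp_permutes)
  have "perm_restrict (opp M) H (perm_restrict (opp M) H x) = x" for x
    using assms by (auto simp: perm_restrict_def opp_closed_def)
  then show "bij_betw (perm_restrict (opp M) H) (arcs (skel M)) (arcs (skel M))"
    by (intro bij_betw_byWitness[where f' = "perm_restrict (opp M) H"])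
      (auto simp: perm_restrict_def)
  show "perm_restrict (opp M) H x = x" if "x \<notin> arcs (skel M)" for x
    using that assms by (auto simp: perm_restrict_def opp_closed_def)
qed

lemma face_perm_permutes: "opp_closed H \<Longrightarrow> face_perm H permutes arcs (skel M)"
  unfolding face_perm_def by (intro permutes_compose perm_restrict_opp_permutes rot_permutes)

lemma permutation_face_perm: "opp_closed H \<Longrightarrow> permutation (face_perm H)"
  using face_perm_permutes finite_arcs permutation_permutes by blast

text \<open>On the deleted edge the transposition undoes \<open>opp\<close>, leaving
  \<open>rot\<close> alone; elsewhere it is the identity.\<close>

lemma face_perm_delete:
  assumes H: "opp_closed H" "a \<in> H"
  shows "face_perm (H - {a, opp M a}) = face_perm H \<circ> transpose a (opp M a)"
proof
  fix x
  show "face_perm (H - {a, opp M a}) x = (face_perm H \<circ> transpose a (opp M a)) x"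
    using opp_closedD[OF H] H(2)
    by (cases "x = a"; cases "x = opp M a") (simp_all add: face_perm_def perm_restrict_def transpose_def)
qed

text \<open>\<open>rot\<close> stays at the vertex, and the restricted involution either crosses an
  edge of \<open>H\<close> or fixes the half-edge. Hence a face never leaves its component.\<close>

lemma tail_face_perm:
  assumes "opp_closed H" "a \<in> arcs (skel M)"
  shows "tail (skel M) (face_perm H a) \<in> comp_of H (tail (skel M) a)"
  using assms head_in_comp_of[of a H "tail (skel M) a"] comp_of_self
  by (auto simp: face_perm_def perm_restrict_def tail_rot)

lemma orbit_face_perm_comp:
  assumes H: "opp_closed H" "a \<in> arcs (skel M)" and "b \<in> orbit (face_perm H) a"
  shows "tail (skel M) b \<in> comp_of H (tail (skel M) a)"
  using assms(3)
proof induction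
  case base show ?case by (rule tail_face_perm[OF H])
next
  case (step y)
  have "y \<in> arcs (skel M)"
    using permutes_orbit_subset[OF face_perm_permutes[OF H(1)] H(2)] step(1) by blast
  then show ?case using step tail_face_perm[OF H(1)] comp_of_trans by blast
qed

text \<open>Faces are lost only if \<open>a\<close> and \<open>opp M a\<close> end up on the same
  orbit of \<open>face_perm H'\<close>; as an orbit lies in one component, the ends of the edge are
  then still connected in \<open>H'\<close>.\<close>

lemma faces_delete:
  assumes H: "opp_closed H" "a \<in> H"
  defines "H' \<equiv> H - {a, opp M a}"
  shows "faces H' = faces H + 1 \<or>
    (faces H = faces H' + 1 \<and> head (skel M) a \<in> comp_of H' (tail (skel M) a))"
proof -
  have aA: "a \<in> arcs (skel M)" using opp_closedD[OF H] by simp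
  have H': "opp_closed H'" unfolding H'_def by (rule opp_closed_delete[OF H(1)])
  have "opp M a \<in> orbit (face_perm H') a \<Longrightarrow> head (skel M) a \<in> comp_of H' (tail (skel M) a)"
    using orbit_face_perm_comp[OF H' aA] aA by fastforce
  then show ?thesis
    using card_orbits_comp_transpose[OF face_perm_permutes[OF H(1)] finite_arcs aA, of "opp M a"]
      aA arev_neq[OF aA] face_perm_delete[OF H]
    unfolding faces_def H'_def by (auto split: if_splits)
qed

lemma rank_delete:
  assumes H: "opp_closed H" "a \<in> H"
  shows "rank H = rank (H - {a, opp M a}) +
    (if head (skel M) a \<in> comp_of (H - {a, opp M a}) (tail (skel M) a) then 1 else 0)"
  using edges_delete[OF H] comps_delete[OF H] by (simp add: rank_def)

text \<open>In 2 K - V + E - F, deleting an edge that lies on no cycle contributes 2 - 1 - 1 = 0.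
  For any other edge K is fixed and E drops by one: this is balanced if F drops too, and lowers the
  value by 2 if F grows.\<close>

lemma double_genus_delete:
  assumes H: "opp_closed H" "a \<in> H"
  defines "H' \<equiv> H - {a, opp M a}"
  shows "double_genus H = double_genus H' \<or>
    (double_genus H = double_genus H' + 2 \<and> rank H = rank H' + 1)"
  using edges_delete[OF H] comps_delete[OF H] faces_delete[OF H] rank_delete[OF H]
  unfolding double_genus_def H'_def by (auto split: if_splits)

section \<open>Rank and genus: base case, bounds and comparison of subsets\<close>

lemma comps_empty: "comps {} = card (verts (skel M))"
  by (simp add: comps_def comp_of_def ends_def card_image)

lemma out_arcs_inj:
  "inj_on (out_arcs (skel M)) {v. out_arcs (skel M) v \<noteq> {}}"
proof (rule inj_onI)
  fix v w
  assume "v \<in> {v. out_arcs (skel M) v \<noteq> {}}" and eq: "out_arcs (skel M) v = out_arcs (skel M) w"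
  then obtain a where "a \<in> out_arcs (skel M) v" by blast
  then have "a \<in> out_arcs (skel M) v" "a \<in> out_arcs (skel M) w" using eq by simp_all
  then show "v = w" by simp
qed

text \<open>Without edges the face permutation is \<open>rot\<close>, whose orbits are the vertices
  carrying half-edges; the second summand of \<open>faces\<close> supplies the remaining
  vertices.\<close>

lemma faces_empty: "faces {} = card (verts (skel M))"
proof -
  have "orbit (face_perm {}) ` arcs (skel M) =
      out_arcs (skel M) ` {v \<in> verts (skel M). out_arcs (skel M) v \<noteq> {}}" (is "?L = ?R")
  proof -
    have "face_perm {} = rot M" by (simp add: face_perm_def perm_restrict_def fun_eq_iff)
    then have "?L = (\<lambda>a. out_arcs (skel M) (tail (skel M) a)) ` arcs (skel M)"
      using orbit_rot by (auto intro: image_cong)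
    also have "\<dots> = ?R" by (auto simp: out_arcs_def)
    finally show ?thesis .
  qed
  then have "faces {} = card {v \<in> verts (skel M). out_arcs (skel M) v \<noteq> {}}
      + card {v \<in> verts (skel M). out_arcs (skel M) v = {}}"
    unfolding faces_def
    using card_image[OF inj_on_subset[OF out_arcs_inj], of "{v \<in> verts (skel M). out_arcs (skel M) v \<noteq> {}}"]
    by (simp add: subset_iff)
  also have "\<dots> = card ({v \<in> verts (skel M). out_arcs (skel M) v \<noteq> {}}
      \<union> {v \<in> verts (skel M). out_arcs (skel M) v = {}})"
    by (intro card_Un_disjoint[symmetric]) auto
  also have "{v \<in> verts (skel M). out_arcs (skel M) v \<noteq> {}}
      \<union> {v \<in> verts (skel M). out_arcs (skel M) v = {}} = verts (skel M)" by blast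
  finally show ?thesis .
qed

lemma rank_empty: "rank {} = 0"
  by (simp add: rank_def edges_def comps_empty)

lemma double_genus_empty: "double_genus {} = 0"
  by (simp add: double_genus_def edges_def comps_empty faces_empty)

lemma rank_nonneg: "opp_closed H \<Longrightarrow> 0 \<le> rank H"
proof (induction rule: opp_closed_induct)
  case (delete H a) then show ?case using rank_delete[OF delete(1,2)] by simp
qed (simp add: rank_empty)

lemma double_genus_nonneg_even: "opp_closed H \<Longrightarrow> 0 \<le> double_genus H \<and> even (double_genus H)"
proof (induction rule: opp_closed_induct)
  case (delete H a) then show ?case using double_genus_delete[OF delete(1,2)] by auto
qed (simp add: double_genus_empty)

text \<open>Each component carries a face: sending an orbit to the component of its tails is well
  defined and reaches every component containing a half-edge. All other components contain a vertex
  counted by the second summand.\<close>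

lemma comps_le_faces:
  assumes H: "opp_closed H"
  shows "comps H \<le> faces H"
proof -
  let ?A = "arcs (skel M)" and ?I = "{v \<in> verts (skel M). out_arcs (skel M) v = {}}"
  have "comp_of H ` verts (skel M) = (\<lambda>a. comp_of H (tail (skel M) a)) ` ?A \<union> comp_of H ` ?I"
  proof -
    have "verts (skel M) = tail (skel M) ` arcs (skel M) \<union> ?I" by (auto simp: out_arcs_def)
    then have "comp_of H ` verts (skel M) = comp_of H ` (tail (skel M) ` arcs (skel M) \<union> ?I)"
      by (rule arg_cong)
    then show ?thesis by (simp only: image_Un image_image)
  qed
  then have "comps H \<le> card ((\<lambda>a. comp_of H (tail (skel M) a)) ` ?A) + card (comp_of H ` ?I)"
    unfolding comps_def by (simp only: card_Un_le)
  moreover have "card (comp_of H ` ?I) \<le> card ?I" by (intro card_image_le) simp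
  moreover have "card ((\<lambda>a. comp_of H (tail (skel M) a)) ` ?A) \<le> card (orbit (face_perm H) ` ?A)"
  proof (rule card_image_le_factor[OF finite_arcs])
    fix a b assume "a \<in> ?A" "b \<in> ?A" and eq: "orbit (face_perm H) a = orbit (face_perm H) b"
    have "a \<in> orbit (face_perm H) b"
      unfolding eq[symmetric] by (rule permutation_self_in_orbit[OF permutation_face_perm[OF H]])
    then show "comp_of H (tail (skel M) a) = comp_of H (tail (skel M) b)"
      using orbit_face_perm_comp[OF H \<open>b \<in> ?A\<close>] comp_of_eq[OF H] by simp
  qed
  ultimately show ?thesis by (simp add: faces_def)
qed

text \<open>The right side minus the left side is \<open>faces H - comps H\<close>.\<close>

lemma double_genus_le_rank: "opp_closed H \<Longrightarrow> double_genus H \<le> rank H"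
  using comps_le_faces[of H] by (simp add: double_genus_def rank_def)

text \<open>Delete the edges outside \<open>H'\<close> one by one: each genus drop costs a unit of
  rank, and rank never grows back. The equality case transfers planarity between the whole map and a
  colour submap of full rank.\<close>

lemma rank_genus_subset:
  assumes "opp_closed H" "opp_closed H'" "H' \<subseteq> H"
  shows "rank H' \<le> rank H \<and> (rank H' = rank H \<longrightarrow> double_genus H' = double_genus H)"
proof -
  have "finite (H - H')" using finite_opp_closed[OF assms(1)] by simp
  then show ?thesis using assms
  proof (induction "H - H'" arbitrary: H rule: finite_psubset_induct)
    case psubset
    show ?case
    proof (cases "H = H'")
      case False
      then obtain a where a: "a \<in> H" "a \<notin> H'" using psubset.prems by blast
      have "opp M a \<notin> H'" using a(2) psubset.prems(2) by (metis arev_arev opp_closedD(2))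
      then have "rank H' \<le> rank (H - {a, opp M a}) \<and> (rank H' = rank (H - {a, opp M a}) \<longrightarrow>
          double_genus H' = double_genus (H - {a, opp M a}))"
        using a psubset.prems by (intro psubset.hyps opp_closed_delete) auto
      then show ?thesis
        using rank_delete[OF psubset.prems(1) a(1)] double_genus_delete[OF psubset.prems(1) a(1)]
        by auto
    qed simp
  qed
qed

text \<open>Deleting an edge affects the rank of its own colour only. If the edge closes a cycle
  within its colour, it also closes one in \<open>H\<close>, so the drop in that colour is at most
  the drop \<open>d\<close> of the whole rank.\<close>

lemma sum_rank_colours_le:
  assumes "opp_closed H"
  shows "(\<Sum>i = 1..D. rank {a \<in> H. colour M a = i}) \<le> rank H"
  using assms
proof (induction rule: opp_closed_induct)
  case (delete H a)
  let ?b = "opp M a" and ?c = "colour M a" and ?H = "\<lambda>i. {x \<in> H. colour M x = i}"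
  have aA: "a \<in> arcs (skel M)" using opp_closedD[OF delete(1,2)] by simp
  define d where "d = rank H - rank (H - {a, ?b})"
  have "rank (?H i) \<le> rank {x \<in> H - {a, ?b}. colour M x = i} + (if i = ?c then d else 0)" for i
  proof (cases "i = ?c")
    case True
    have eq: "{x \<in> H - {a, ?b}. colour M x = ?c} = ?H ?c - {a, ?b}" by auto
    have "comp_of (?H ?c - {a, ?b}) v \<subseteq> comp_of (H - {a, ?b}) v" for v
      by (rule comp_of_mono) auto
    then show ?thesis
      using rank_delete[OF opp_closed_Int_colour[OF delete(1)], of a ?c]
        rank_delete[OF delete(1,2)] delete(2)
      unfolding True d_def eq by auto
  next
    case False
    then have "{x \<in> H - {a, ?b}. colour M x = i} = ?H i" using colour_opp[OF aA] by auto
    then show ?thesis using False by simp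
  qed
  then have "(\<Sum>i = 1..D. rank (?H i)) \<le>
      (\<Sum>i = 1..D. rank {x \<in> H - {a, ?b}. colour M x = i} + (if i = ?c then d else 0))"
    by (rule sum_mono)
  also have "\<dots> = (\<Sum>i = 1..D. rank {x \<in> H - {a, ?b}. colour M x = i}) + d"
    using colour_range[OF aA] by (simp add: sum.distrib)
  also have "\<dots> \<le> rank H" using delete(3) by (simp add: d_def)
  finally show ?case .
qed (simp add: rank_empty)

subsection \<open>Colour submaps\<close>

abbreviation submap_skel :: "'h set \<Rightarrow> ('v, 'h) pre_digraph" where
  "submap_skel H \<equiv> (skel M)\<lparr>arcs := H\<rparr>"

lemma wf_submap_skel: "opp_closed H \<Longrightarrow> wf_digraph (submap_skel H)"
  by unfold_locales (auto simp: opp_closed_def)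

lemma reachable_submap_skel:
  assumes H: "opp_closed H" and u: "u \<in> verts (skel M)"
  shows "reachable (submap_skel H) u v \<longleftrightarrow> v \<in> comp_of H u"
proof -
  interpret G: wf_digraph "submap_skel H" by (rule wf_submap_skel[OF H])
  have ends: "arcs_ends (submap_skel H) = ends H" by (simp add: arcs_ends_conv ends_def)
  show ?thesis
  proof
    assume "reachable (submap_skel H) u v"
    then show "v \<in> comp_of H u"
      using reachable_rtranclI by (metis Image_singleton_iff comp_of_def ends)
  next
    assume "v \<in> comp_of H u"
    then have "(u, v) \<in> (ends H)\<^sup>*" by (simp add: comp_of_def)
    then show "reachable (submap_skel H) u v"
    proof induction
      case base then show ?case using u by (simp add: G.reachable_refl)
    next
      case (step y z)
      then show ?case using G.reachable_adj_trans ends by metis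
    qed
  qed
qed

lemma comp_of_subset_verts:
  assumes "opp_closed H" "v \<in> verts (skel M)"
  shows "comp_of H v \<subseteq> verts (skel M)"
  using assms by (intro comp_of_least) (auto dest: opp_closedD)

lemma card_sccs_verts_submap:
  assumes H: "opp_closed H"
  shows "card (pre_digraph.sccs_verts (submap_skel H)) = comps H"
proof -
  interpret G: wf_digraph "submap_skel H" by (rule wf_submap_skel[OF H])
  have "G.scc_of u = comp_of H u" if u: "u \<in> verts (skel M)" for u
  proof (intro set_eqI)
    fix v
    have "v \<in> G.scc_of u \<longleftrightarrow> v \<in> comp_of H u \<and> reachable (submap_skel H) v u"
      using reachable_submap_skel[OF H u] by (simp add: G.scc_of_def)
    also have "\<dots> \<longleftrightarrow> v \<in> comp_of H u"
      using reachable_submap_skel[OF H, of v u] comp_of_subset_verts[OF H u] comp_of_sym[OF H, of v u]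
      by blast
    finally show "v \<in> G.scc_of u \<longleftrightarrow> v \<in> comp_of H u" .
  qed
  then show ?thesis unfolding G.sccs_verts_conv_scc_of comps_def by simp
qed

lemma permutation_rot: "permutation (rot M)"
  using permutation_permutes rot_permutes finite_arcs by blast

text \<open>The permutation whose orbits \<open>num_faces\<close> counts in a colour submap. It
  skips the half-edges outside \<open>H\<close>, whereas \<open>face_perm H\<close> passes through
  them.\<close>

definition face_perm_submap :: "'h set \<Rightarrow> 'h \<Rightarrow> 'h" where
  "face_perm_submap H = first_return (rot M) H \<circ> perm_restrict (opp M) H"

text \<open>After crossing the edge of \<open>x\<close>, \<open>face_perm H\<close> acts as
  \<open>rot\<close> as long as it is outside \<open>H\<close>. So both walks come back to
  \<open>H\<close> at the same moment and at the same half-edge.\<close>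

lemma face_perm_submap_eq:
  assumes H: "opp_closed H" and x: "x \<in> H"
  shows "face_perm_submap H x = first_return (face_perm H) H x"
    and "face_perm_submap H x \<in> H"
proof -
  let ?y = "opp M x" and ?f = "face_perm H"
  have y: "?y \<in> H" using opp_closedD[OF H x] by simp
  have "?y \<in> orbit (rot M) ?y"
    by (rule permutation_self_in_orbit[OF permutation_rot])
  then obtain m where m: "0 < m" "?y = (rot M ^^ m) ?y" unfolding orbit_altdef by blast
  have "(rot M ^^ m) ?y \<in> H" using y m(2)[symmetric] by simp
  from y this m(1) obtain n where n: "0 < n" "first_return (rot M) H ?y = (rot M ^^ n) ?y"
    "(rot M ^^ n) ?y \<in> H" "\<And>k. 0 < k \<Longrightarrow> k < n \<Longrightarrow> (rot M ^^ k) ?y \<notin> H"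
    by (rule first_return_steps) blast
  have pow: "0 < k \<Longrightarrow> k \<le> n \<Longrightarrow> (?f ^^ k) x = (rot M ^^ k) ?y" for k
  proof (induction k)
    case (Suc k)
    show ?case
    proof (cases "k = 0")
      case True then show ?thesis using x by (simp add: face_perm_def perm_restrict_def)
    next
      case False
      then show ?thesis using Suc n(4)[of k] by (simp add: face_perm_def perm_restrict_def)
    qed
  qed simp
  have "first_return ?f H x = (?f ^^ n) x"
    using n pow x by (intro first_return_eqI) auto
  then show "face_perm_submap H x = first_return ?f H x" "face_perm_submap H x \<in> H"
    using n pow x by (auto simp: face_perm_submap_def perm_restrict_def)
qed

lemma orbit_face_perm_submap:
  assumes H: "opp_closed H" and x: "x \<in> H"
  shows "orbit (face_perm_submap H) x = orbit (face_perm H) x \<inter> H"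
proof -
  have "orbit (face_perm_submap H) x = orbit (first_return (face_perm H) H) x"
    using face_perm_submap_eq[OF H] by (intro orbit_cong0[OF x]) auto
  then show ?thesis using orbit_first_return[OF permutation_face_perm[OF H] x] by simp
qed

text \<open>Either alternative makes \<open>face_perm H\<close> agree with \<open>rot\<close> along
  a whole orbit. The first starts from a vertex without half-edges in \<open>H\<close>, the second
  from an orbit avoiding \<open>H\<close>; \<open>card_faces_submap\<close> needs one for each
  inclusion.\<close>

lemma orbit_face_perm_outside:
  assumes H: "opp_closed H" and x: "x \<in> arcs (skel M)"
    and disj: "out_arcs (skel M) (tail (skel M) x) \<inter> H = {} \<or> orbit (face_perm H) x \<inter> H = {}"
  shows "orbit (face_perm H) x = out_arcs (skel M) (tail (skel M) x)"
proof -
  have self: "x \<in> orbit (rot M) x" "x \<in> orbit (face_perm H) x"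
    using permutation_rot permutation_face_perm[OF H] by (auto intro: permutation_self_in_orbit)
  have eq: "face_perm H y = rot M y" if "y \<notin> H" for y
    using that by (simp add: face_perm_def perm_restrict_def)
  from disj have "orbit (face_perm H) x = orbit (rot M) x"
  proof
    assume "out_arcs (skel M) (tail (skel M) x) \<inter> H = {}"
    then have "s \<notin> H" if "s \<in> orbit (rot M) x" for s using that orbit_rot[OF x] by blast
    then show ?thesis using eq by (intro orbit_cong[OF self(1)]) simp
  next
    assume "orbit (face_perm H) x \<inter> H = {}"
    then have "s \<notin> H" if "s \<in> orbit (face_perm H) x" for s using that by blast
    then show ?thesis using eq by (intro orbit_cong[OF self(2), symmetric]) simp
  qed
  then show ?thesis by (simp add: orbit_rot[OF x])
qed

lemma card_faces_submap:
  assumes H: "opp_closed H"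
  shows "card (orbit (face_perm_submap H) ` H) +
    card {v \<in> verts (skel M). out_arcs (submap_skel H) v = {}} = faces H"
proof -
  let ?f = "face_perm H" and ?A = "arcs (skel M)" and ?V = "verts (skel M)" and ?o = "out_arcs (skel M)"
  \<comment> \<open>The vertices isolated by the restriction but not in the whole map: an orbit on
    the full side, an isolated vertex on the submap side.\<close>
  let ?N = "{v \<in> ?V. ?o v \<noteq> {} \<and> ?o v \<inter> H = {}}"
  have HA: "H \<subseteq> ?A" using H by (simp add: opp_closed_def)
  have perm: "permutation ?f" by (rule permutation_face_perm[OF H])
  have self: "x \<in> orbit ?f x" for x using perm by (rule permutation_self_in_orbit)
  have "orbit (face_perm_submap H) ` H = (\<lambda>X. X \<inter> H) ` orbit ?f ` H"
    unfolding image_image by (intro image_cong refl orbit_face_perm_submap[OF H])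
  moreover have "inj_on (\<lambda>X. X \<inter> H) (orbit ?f ` H)"
  proof (rule inj_onI)
    fix P Q assume "P \<in> orbit ?f ` H" "Q \<in> orbit ?f ` H" and eq: "P \<inter> H = Q \<inter> H"
    then obtain x y where x: "x \<in> H" "P = orbit ?f x" and y: "Q = orbit ?f y" by blast
    then have "x \<in> orbit ?f y" using eq self[of x] by blast
    then show "P = Q" using orbit_eqI_permutation[OF perm] x y by simp
  qed
  ultimately have 1: "card (orbit (face_perm_submap H) ` H) = card (orbit ?f ` H)"
    by (simp add: card_image)
  have 2: "orbit ?f ` ?A = orbit ?f ` H \<union> ?o ` ?N"
  proof (intro equalityI subsetI)
    fix P assume "P \<in> orbit ?f ` ?A"
    then obtain x where x: "x \<in> ?A" "P = orbit ?f x" by blast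
    show "P \<in> orbit ?f ` H \<union> ?o ` ?N"
    proof (cases "P \<inter> H = {}")
      case True
      then have "P = ?o (tail (skel M) x)" using orbit_face_perm_outside[OF H x(1)] x(2) by blast
      moreover have "x \<in> P" using x(2) self by simp
      ultimately have "tail (skel M) x \<in> ?N" using True x(1) by auto
      then show ?thesis using \<open>P = ?o (tail (skel M) x)\<close> by blast
    next
      case False
      then obtain y where "y \<in> P" "y \<in> H" by blast
      then have "P = orbit ?f y" using orbit_eqI_permutation[OF perm] x(2) by simp
      then show ?thesis using \<open>y \<in> H\<close> by blast
    qed
  next
    fix P assume "P \<in> orbit ?f ` H \<union> ?o ` ?N"
    then consider "P \<in> orbit ?f ` H" | v where "v \<in> ?N" "P = ?o v" by blast
    then show "P \<in> orbit ?f ` ?A"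
    proof cases
      case 1 then show ?thesis using HA by blast
    next
      case 2
      then obtain x where "x \<in> ?o v" by blast
      then have x: "x \<in> ?A" "tail (skel M) x = v" by auto
      then have "orbit ?f x = P" using orbit_face_perm_outside[OF H x(1)] 2 by simp
      then show ?thesis using x(1) by blast
    qed
  qed
  have "orbit ?f ` H \<inter> ?o ` ?N = {}" using self by fastforce
  then have 3: "card (orbit ?f ` ?A) = card (orbit ?f ` H) + card ?N"
    unfolding 2 using finite_opp_closed[OF H] card_image[OF inj_on_subset[OF out_arcs_inj], of ?N]
    by (subst card_Un_disjoint) auto
  have "{v \<in> ?V. out_arcs (submap_skel H) v = {}} = ?N \<union> {v \<in> ?V. ?o v = {}}"
    using HA by (auto simp: out_arcs_def)
  then have "card {v \<in> ?V. out_arcs (submap_skel H) v = {}} = card ?N + card {v \<in> ?V. ?o v = {}}"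
    by (simp only:) (intro card_Un_disjoint, auto)
  then show ?thesis using 1 3 by (simp add: faces_def)
qed

abbreviation colour_arcs :: "nat \<Rightarrow> 'h set" where
  "colour_arcs i \<equiv> {a \<in> arcs (skel M). colour M a = i}"

lemma opp_closed_colour_arcs: "opp_closed (colour_arcs i)"
  by (rule opp_closed_Int_colour[OF opp_closed_arcs])

lemma num_faces_colour_submap: "num_faces (colour_submap M i) = faces (colour_arcs i)"
  using card_faces_submap[OF opp_closed_colour_arcs, of i]
  by (simp add: num_faces_def colour_submap_def Let_def face_perm_submap_def)

lemma circuit_rank_colour_submap: "circuit_rank (colour_submap M i) = rank (colour_arcs i)"
proof -
  have "edge_of (colour_submap M i) ` colour_arcs i = edge_of M ` colour_arcs i"
    by (intro image_cong) (auto simp: edge_of_def colour_submap_def Let_def perm_restrict_def)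
  then have "num_edges (colour_submap M i) = edges (colour_arcs i)"
    by (simp add: num_edges_def edges_def colour_submap_def Let_def)
  moreover have "num_comps (colour_submap M i) = comps (colour_arcs i)"
    using card_sccs_verts_submap[OF opp_closed_colour_arcs, of i]
    by (simp add: num_comps_def colour_submap_def Let_def)
  moreover have "num_verts (colour_submap M i) = card (verts (skel M))"
    by (simp add: num_verts_def colour_submap_def Let_def)
  ultimately show ?thesis by (simp add: circuit_rank_def rank_def)
qed

lemma num_comps_eq: "num_comps M = comps (arcs (skel M))"
  using card_sccs_verts_submap[OF opp_closed_arcs] by (simp add: num_comps_def)

lemma num_edges_eq: "num_edges M = edges (arcs (skel M))"
  by (simp add: num_edges_def edges_def)

lemma num_faces_eq: "num_faces M = faces (arcs (skel M))"
  using arev_permutes_arcs by (simp add: num_faces_def faces_def face_perm_def)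

lemma circuit_rank_eq: "circuit_rank M = rank (arcs (skel M))"
  by (simp add: circuit_rank_def rank_def num_comps_eq num_edges_eq num_verts_def)

lemma planar_map_iff: "planar_map M \<longleftrightarrow> double_genus (arcs (skel M)) = 0"
  unfolding planar_map_def genus_def double_genus_def num_comps_eq num_edges_eq num_faces_eq num_verts_def
  by simp linarith

lemma sum_edges_colours: "(\<Sum>i = 1..D. edges (colour_arcs i)) = edges (arcs (skel M))"
proof -
  have "edge_of M ` arcs (skel M) = (\<Union>i\<in>{1..D}. edge_of M ` colour_arcs i)"
  proof (intro equalityI subsetI)
    fix e assume "e \<in> edge_of M ` arcs (skel M)"
    then obtain a where "a \<in> arcs (skel M)" "e = edge_of M a" by blast
    then show "e \<in> (\<Union>i\<in>{1..D}. edge_of M ` colour_arcs i)"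
      using colour_range[of a] by (intro UN_I[of "colour M a"] image_eqI[of _ _ a]) simp_all
  qed blast
  moreover have "edge_of M ` colour_arcs i \<inter> edge_of M ` colour_arcs j = {}" if "i \<noteq> j" for i j
    using that by (auto simp: edge_of_def doubleton_eq_iff colour_opp)
  ultimately show ?thesis
    unfolding edges_def by (simp add: card_UN_disjoint)
qed

lemma comps_connected:
  assumes "Digraph_Component.connected (skel M)"
  shows "comps (arcs (skel M)) = 1"
proof -
  have sc: "strongly_connected (skel M)"
    using symmetric_connected_imp_strongly_connected sym_arcs assms by blast
  have "comp_of (arcs (skel M)) v = verts (skel M)" if v: "v \<in> verts (skel M)" for v
  proof
    show "comp_of (arcs (skel M)) v \<subseteq> verts (skel M)"
      by (rule comp_of_subset_verts[OF opp_closed_arcs v])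
    show "verts (skel M) \<subseteq> comp_of (arcs (skel M)) v"
      using sc reachable_submap_skel[OF opp_closed_arcs v] v by (auto simp: strongly_connected_def)
  qed
  then have "comp_of (arcs (skel M)) ` verts (skel M) = {verts (skel M)}"
    using sc by (auto simp: strongly_connected_def)
  then show ?thesis by (simp add: comps_def)
qed

text \<open>Eliminating K between rank and genus gives
  \<open>F\<^sub>i = 2 L\<^sub>i - 2 g\<^sub>i - E\<^sub>i + V\<close> for each colour. In the sum
  the \<open>E\<^sub>i\<close> add up to E, and the constant D of the degree provides the term K = 1
  in D copies of L = E - V + K.\<close>

lemma map_degree_eq:
  assumes "Digraph_Component.connected (skel M)"
  shows "map_degree D M = int D * circuit_rank M
    - 2 * (\<Sum>i = 1..D. rank (colour_arcs i)) + (\<Sum>i = 1..D. double_genus (colour_arcs i))"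
proof -
  let ?V = "int (card (verts (skel M)))" and ?E = "int (edges (arcs (skel M)))"
  have "int (faces (colour_arcs i)) = 2 * rank (colour_arcs i) - double_genus (colour_arcs i)
      - int (edges (colour_arcs i)) + ?V" for i
    by (simp add: rank_def double_genus_def)
  then have "(\<Sum>i = 1..D. int (num_faces (colour_submap M i))) =
      2 * (\<Sum>i = 1..D. rank (colour_arcs i)) - (\<Sum>i = 1..D. double_genus (colour_arcs i))
      - (\<Sum>i = 1..D. int (edges (colour_arcs i))) + int D * ?V"
    by (simp add: num_faces_colour_submap sum.distrib sum_subtractf sum_distrib_left)
  moreover have "(\<Sum>i = 1..D. int (edges (colour_arcs i))) = ?E"
    using sum_edges_colours by (metis of_nat_sum)
  ultimately show ?thesis
    using comps_connected[OF assms] unfolding map_degree_def circuit_rank_eq rank_def[of "arcs (skel M)"] num_edges_eq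
    by (simp add: algebra_simps)
qed

subsection \<open>Cycles\<close>

lemma awalk_comp_of:
  assumes "awalk u p v" "set p \<subseteq> H"
  shows "v \<in> comp_of H u"
  using assms
proof (induction p arbitrary: u)
  case Nil then show ?case by (simp add: awalk_Nil_iff comp_of_self)
next
  case (Cons e p)
  then have "v \<in> comp_of H (head (skel M) e)" "u = tail (skel M) e" "e \<in> H"
    by (auto simp: awalk_Cons_iff)
  then show ?case using head_in_comp_of comp_of_self comp_of_trans by metis
qed

lemma comp_of_awalk:
  assumes H: "opp_closed H" and u: "u \<in> verts (skel M)" and v: "v \<in> comp_of H u"
  obtains p where "apath u p v" "set p \<subseteq> H"
proof -
  have "(u, v) \<in> (ends H)\<^sup>*" using v by (simp add: comp_of_def)
  then have "\<exists>p. awalk u p v \<and> set p \<subseteq> H"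
  proof induction
    case base then show ?case using u by (intro exI[of _ "[]"]) (simp add: awalk_Nil_iff)
  next
    case (step y z)
    then obtain p e where p: "awalk u p y" "set p \<subseteq> H" and e: "e \<in> H" "tail (skel M) e = y" "head (skel M) e = z"
      by (auto simp: ends_def)
    then have "awalk y [e] z" using arc_implies_awalk[of e] opp_closedD[OF H] by auto
    then have "awalk u (p @ [e]) z" by (rule awalk_appendI[OF p(1)])
    then show ?case using p(2) e(1) by (intro exI[of _ "p @ [e]"]) simp
  qed
  then obtain p where p: "awalk u p v" "set p \<subseteq> H" by blast
  show ?thesis
    using that[OF apath_awalk_to_apath[OF p(1)]] awalk_to_apath_subset[OF p(1)] p(2) by blast
qed

text \<open>The reverse of a half-edge ends at its tail, a vertex which a path does not visit again.
  This supplies the condition in \<open>cycles\<close> that no edge be traversed in both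
  directions.\<close>

lemma apath_opp:
  assumes "apath u p v" "x \<in> set p"
  shows "opp M x \<notin> set p"
  using assms
proof (induction p arbitrary: u)
  case (Cons e p)
  then have e: "e \<in> arcs (skel M)" and p: "apath (head (skel M) e) p v"
    and tl: "tail (skel M) e \<notin> set (awalk_verts (head (skel M) e) p)"
    by (auto simp: apath_Cons_iff)
  have "opp M e \<notin> set p"
    using tl awalk_verts_arc2[OF awalkI_apath[OF p], of "opp M e"] e by auto
  then show ?case using Cons.IH[OF p] Cons.prems(2) arev_neq[OF e] by auto
qed simp

definition cycles_in :: "'h set \<Rightarrow> 'h set set set" where
  "cycles_in H = {C \<in> cycles M. C \<subseteq> edge_of M ` H}"

lemma cycle_nonempty: "C \<in> cycles M \<Longrightarrow> C \<noteq> {}"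
  unfolding cycles_def cycle_def by blast

lemma edge_of_eq_iff: "edge_of M x = edge_of M y \<longleftrightarrow> x = y \<or> x = opp M y"
proof
  have "x \<in> edge_of M x" by (simp add: edge_of_def)
  also assume "edge_of M x = edge_of M y"
  finally have "x \<in> edge_of M y" .
  then show "x = y \<or> x = opp M y" by (simp add: edge_of_def)
qed (auto simp: edge_of_def)

lemma cycles_in_arcs: "cycles_in (arcs (skel M)) = cycles M"
proof -
  have "C \<subseteq> edge_of M ` arcs (skel M)" if "C \<in> cycles M" for C
    using that unfolding cycles_def cycle_def awalk_def by blast
  then show ?thesis unfolding cycles_in_def by blast
qed

lemma cycles_in_empty: "cycles_in {} = {}"
  using cycle_nonempty unfolding cycles_in_def by blast

lemma cycles_in_delete:
  assumes H: "opp_closed H" "a \<in> H"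
  shows "cycles_in (H - {a, opp M a}) = {C \<in> cycles_in H. edge_of M a \<notin> C}"
proof -
  have "edge_of M ` (H - {a, opp M a}) = edge_of M ` H - {edge_of M a}"
  proof -
    have "edge_of M x = edge_of M a \<longleftrightarrow> x \<in> {a, opp M a}" for x
      unfolding edge_of_eq_iff by blast
    then show ?thesis by blast
  qed
  then show ?thesis
    by (simp only: cycles_in_def subset_Diff_insert Diff_empty mem_Collect_eq conj_assoc)
qed

text \<open>A path joining the ends of the edge without using it is closed by \<open>a\<close> to a
  cycle; conversely, a cycle cut open at one of its edges leaves such a connection.\<close>

lemma cycle_through_iff:
  assumes H: "opp_closed H" "a \<in> H"
  shows "head (skel M) a \<in> comp_of (H - {a, opp M a}) (tail (skel M) a) \<longleftrightarrow>
    (\<exists>C \<in> cycles_in H. edge_of M a \<in> C)"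
proof
  have aA: "a \<in> arcs (skel M)" using opp_closedD[OF H] by simp
  let ?H' = "H - {a, opp M a}"
  have H': "opp_closed ?H'" by (rule opp_closed_delete[OF H(1)])
  {
    assume "head (skel M) a \<in> comp_of ?H' (tail (skel M) a)"
    then have "tail (skel M) a \<in> comp_of ?H' (head (skel M) a)" by (rule comp_of_sym[OF H'])
    then obtain p where p: "apath (head (skel M) a) p (tail (skel M) a)" "set p \<subseteq> ?H'"
      using comp_of_awalk[OF H'] aA by (metis head_in_verts)
    have "awalk (tail (skel M) a) (a # p) (tail (skel M) a)"
      using p(1) aA by (simp add: awalk_Cons_iff apath_def)
    moreover have "distinct (tl (awalk_verts (tail (skel M) a) (a # p)))"
      using p(1) by (simp add: apath_def)
    ultimately have "cycle (a # p)" unfolding cycle_def by blast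
    moreover have "opp M x \<notin> set (a # p)" if "x \<in> set (a # p)" for x
    proof (cases "x = a")
      case True then show ?thesis using p(2) arev_neq[OF aA] by auto
    next
      case False
      then have "x \<in> set p" using that by simp
      moreover from this have "opp M x \<noteq> a" using p(2) by auto
      ultimately show ?thesis using apath_opp[OF p(1)] by simp
    qed
    ultimately have "edge_of M ` set (a # p) \<in> cycles M" unfolding cycles_def by blast
    moreover have "edge_of M ` set (a # p) \<subseteq> edge_of M ` H" using p(2) H(2) by auto
    ultimately show "\<exists>C \<in> cycles_in H. edge_of M a \<in> C"
      by (intro bexI[of _ "edge_of M ` set (a # p)"]) (simp_all add: cycles_in_def)
  next
    assume "\<exists>C \<in> cycles_in H. edge_of M a \<in> C"
    then obtain p where cyc: "cycle p" and opp: "\<And>x. x \<in> set p \<Longrightarrow> opp M x \<notin> set p"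
      and sub: "edge_of M ` set p \<subseteq> edge_of M ` H" and "edge_of M a \<in> edge_of M ` set p"
      unfolding cycles_in_def cycles_def by blast
    then obtain e where e: "e \<in> set p" "edge_of M a = edge_of M e" by blast
    \<comment> \<open>A cycle records edges only, so it may run through this one in either
      direction. The argument uses the half-edge \<open>e\<close> actually traversed, and symmetry
      of \<open>comp_of\<close> settles the orientation at the end.\<close>
    then have ea: "e = a \<or> e = opp M a" using edge_of_eq_iff[of e a] by simp
    have pH: "set p \<subseteq> H"
    proof
      fix x assume "x \<in> set p"
      then obtain y where "y \<in> H" "edge_of M x = edge_of M y" using sub by blast
      then show "x \<in> H" using opp_closedD[OF H(1)] edge_of_eq_iff[of x y] by auto
    qed
    from cyc obtain u where u: "awalk u p u" "distinct p" unfolding cycle_conv by blast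
    obtain q r where qr: "p = q @ e # r" using e(1) by (meson split_list)
    have "awalk u q (tail (skel M) e)" "awalk (head (skel M) e) r u"
      using u(1) unfolding qr by (auto simp: awalk_Cons_iff)
    then have "awalk (head (skel M) e) (r @ q) (tail (skel M) e)" by (intro awalk_appendI)
    \<comment> \<open>Distinctness of the walk excludes \<open>e\<close>, and the ban on traversing
      an edge both ways excludes \<open>opp M e\<close>.\<close>
    moreover have "set (r @ q) \<subseteq> ?H'"
    proof
      fix x assume x: "x \<in> set (r @ q)"
      then have "x \<in> H" "x \<noteq> e" "x \<noteq> opp M e"
        using pH u(2) opp[OF e(1)] unfolding qr by auto
      then show "x \<in> ?H'" using ea by auto
    qed
    ultimately have "tail (skel M) e \<in> comp_of ?H' (head (skel M) e)" by (rule awalk_comp_of)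
    then show "head (skel M) a \<in> comp_of ?H' (tail (skel M) a)"
      using ea comp_of_sym[OF H'] aA by auto
  }
qed

lemma rank_delete_cycle:
  assumes H: "opp_closed H" "a \<in> H"
  shows "rank H = rank (H - {a, opp M a}) + (if \<exists>C \<in> cycles_in H. edge_of M a \<in> C then 1 else 0)"
  unfolding cycle_through_iff[OF H, symmetric] by (rule rank_delete[OF H])

lemma rank_eq_0_iff:
  assumes "opp_closed H"
  shows "rank H = 0 \<longleftrightarrow> cycles_in H = {}"
  using assms
proof (induction rule: opp_closed_induct)
  case empty then show ?case by (simp add: rank_empty cycles_in_empty)
next
  case (delete H a)
  then show ?case
    using rank_delete_cycle[OF delete(1,2)] cycles_in_delete[OF delete(1,2)]
      rank_nonneg[OF opp_closed_delete[OF delete(1)], of a]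
    by (auto split: if_splits)
qed

text \<open>At rank 1, deleting any edge of a cycle leaves rank 0 and so destroys all cycles. Every
  edge of one cycle thus lies on every other, and two cycles contain each other. Conversely,
  deleting an edge of the only cycle leaves none.\<close>

lemma rank_eq_1_iff:
  assumes H: "opp_closed H"
  shows "rank H = 1 \<longleftrightarrow> (\<exists>C. cycles_in H = {C})"
proof
  have edge: "\<exists>a \<in> H. e = edge_of M a" if "C \<in> cycles_in H" "e \<in> C" for C e
    using that by (auto simp: cycles_in_def)
  {
    assume r: "rank H = 1"
    have sub: "C \<subseteq> C'" if CC': "C \<in> cycles_in H" "C' \<in> cycles_in H" for C C'
    proof
      fix e assume "e \<in> C"
      then obtain a where a: "a \<in> H" "e = edge_of M a" using edge[OF CC'(1)] by blast
      then have "\<exists>C \<in> cycles_in H. edge_of M a \<in> C" using CC'(1) \<open>e \<in> C\<close> by blast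
      then have "rank (H - {a, opp M a}) = 0"
        using rank_delete_cycle[OF H a(1)] r by simp
      then have "{C \<in> cycles_in H. edge_of M a \<notin> C} = {}"
        using rank_eq_0_iff[OF opp_closed_delete[OF H]] cycles_in_delete[OF H a(1)] by simp
      then show "e \<in> C'" using CC'(2) a(2) by blast
    qed
    have "cycles_in H \<noteq> {}" using rank_eq_0_iff[OF H] r by auto
    then obtain C where C: "C \<in> cycles_in H" by blast
    have "C' = C" if "C' \<in> cycles_in H" for C'
      by (rule subset_antisym[OF sub[OF that C] sub[OF C that]])
    then show "\<exists>C. cycles_in H = {C}" using C by blast
  next
    assume "\<exists>C. cycles_in H = {C}"
    then obtain C where C: "cycles_in H = {C}" by blast
    then have "C \<noteq> {}" using cycle_nonempty by (auto simp: cycles_in_def)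
    then obtain a where a: "a \<in> H" "edge_of M a \<in> C" using edge C by blast
    then have "cycles_in (H - {a, opp M a}) = {}" using cycles_in_delete[OF H a(1)] C by auto
    then have "rank (H - {a, opp M a}) = 0" using rank_eq_0_iff[OF opp_closed_delete[OF H]] by simp
    then show "rank H = 1" using rank_delete_cycle[OF H a(1)] C a(2) by simp
  }
qed

section \<open>Colours of cycles and the types of maps with small circuit rank\<close>

lemma monochromatic_iff:
  assumes C: "C \<in> cycles M"
  shows "monochromatic M C \<longleftrightarrow> (\<exists>i \<in> {1..D}. C \<in> cycles_in (colour_arcs i))"
proof
  have edge: "\<exists>a \<in> arcs (skel M). e = edge_of M a" if "e \<in> C" for e
    using that C cycles_in_arcs by (auto simp: cycles_in_def)
  {
    assume "monochromatic M C"
    then obtain i where i: "\<And>e a. e \<in> C \<Longrightarrow> a \<in> e \<Longrightarrow> colour M a = i"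
      unfolding monochromatic_def by blast
    have sub: "\<exists>a \<in> colour_arcs i. e = edge_of M a" if "e \<in> C" for e
      using edge[OF that] i[OF that] by (auto simp: edge_of_def)
    obtain e where "e \<in> C" using cycle_nonempty[OF C] by blast
    then obtain a where "a \<in> colour_arcs i" using sub by blast
    then have "i \<in> {1..D}" using colour_range[of a] by simp
    moreover have "C \<in> cycles_in (colour_arcs i)" using C sub by (auto simp: cycles_in_def)
    ultimately show "\<exists>i \<in> {1..D}. C \<in> cycles_in (colour_arcs i)" by blast
  next
    assume "\<exists>i \<in> {1..D}. C \<in> cycles_in (colour_arcs i)"
    then obtain i where "C \<subseteq> edge_of M ` colour_arcs i" by (auto simp: cycles_in_def)
    then show "monochromatic M C"
      unfolding monochromatic_def by (intro exI[of _ i]) (auto simp: edge_of_def colour_opp)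
  }
qed

lemma polychromatic_iff:
  assumes C: "C \<in> cycles M"
  shows "polychromatic M C \<longleftrightarrow> \<not> monochromatic M C"
proof -
  from C obtain e where "e \<in> C" using cycle_nonempty by blast
  then have "e \<in> edge_of M ` arcs (skel M)" using C \<open>e \<in> C\<close> cycles_in_arcs by (auto simp: cycles_in_def)
  then obtain a where a: "a \<in> e" by (auto simp: edge_of_def)
  show ?thesis
  proof
    assume "polychromatic M C"
    then show "\<not> monochromatic M C" unfolding polychromatic_def monochromatic_def by fastforce
  next
    assume "\<not> monochromatic M C"
    then obtain f b where "f \<in> C" "b \<in> f" "colour M b \<noteq> colour M a"
      unfolding monochromatic_def by blast
    then show "polychromatic M C" using \<open>e \<in> C\<close> a unfolding polychromatic_def by blast
  qed
qed

lemmas colour_rank_nonneg = rank_nonneg[OF opp_closed_colour_arcs]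
lemmas colour_genus_nonneg_even = double_genus_nonneg_even[OF opp_closed_colour_arcs]
lemmas colour_genus_le_rank = double_genus_le_rank[OF opp_closed_colour_arcs]

lemma sum_colour_rank_le: "(\<Sum>i = 1..D. rank (colour_arcs i)) \<le> circuit_rank M"
  using sum_rank_colours_le[OF opp_closed_arcs] by (simp add: circuit_rank_eq)

text \<open>Twice the genus is even, nonnegative and at most the rank, so 1 is excluded by
  parity.\<close>

lemma colour_genus_eq_0:
  assumes "rank (colour_arcs i) \<le> 1"
  shows "double_genus (colour_arcs i) = 0"
proof -
  have "double_genus (colour_arcs i) = 0 \<or> double_genus (colour_arcs i) = 1"
    using colour_genus_nonneg_even[of i] colour_genus_le_rank[of i] assms by linarith
  then show ?thesis using colour_genus_nonneg_even[of i] by auto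
qed

text \<open>The sum is 0 or 1, being bounded by the circuit rank 1. It is nonzero exactly if some
  colour contains a cycle, which can only be \<open>C\<close>.\<close>

lemma monochromatic_unique_cycle_iff:
  assumes "cycles M = {C}"
  shows "monochromatic M C \<longleftrightarrow> (\<Sum>i = 1..D. rank (colour_arcs i)) = 1"
proof -
  have one: "circuit_rank M = 1"
    using assms rank_eq_1_iff[OF opp_closed_arcs] by (simp add: cycles_in_arcs circuit_rank_eq)
  have "C \<in> cycles_in (colour_arcs i) \<longleftrightarrow> rank (colour_arcs i) \<noteq> 0" for i
    unfolding rank_eq_0_iff[OF opp_closed_colour_arcs] using assms by (auto simp: cycles_in_def)
  then have "monochromatic M C \<longleftrightarrow> (\<exists>i \<in> {1..D}. rank (colour_arcs i) \<noteq> 0)"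
    using monochromatic_iff[of C] assms by simp
  also have "\<dots> \<longleftrightarrow> (\<Sum>i = 1..D. rank (colour_arcs i)) \<noteq> 0"
    using sum_nonneg_eq_0_iff[of "{1..D}" "\<lambda>i. rank (colour_arcs i)"] colour_rank_nonneg by auto
  also have "\<dots> \<longleftrightarrow> (\<Sum>i = 1..D. rank (colour_arcs i)) = 1"
    using sum_colour_rank_le one sum_nonneg[of "{1..D}" "\<lambda>i. rank (colour_arcs i)"] colour_rank_nonneg
    by auto
  finally show ?thesis .
qed

text \<open>With two colours of rank 1 all colour genera vanish by parity. With one colour of rank 2
  its genus is that of the whole map; this is why planarity is demanded in that case only.\<close>

lemma two_cycle_types:
  assumes two: "circuit_rank M = 2"
  shows "(planar_map M \<and> (\<exists>i \<in> {1..D}. rank (colour_arcs i) = 2)) \<or>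
      (\<exists>i \<in> {1..D}. \<exists>j \<in> {1..D}. i \<noteq> j \<and> rank (colour_arcs i) = 1 \<and> rank (colour_arcs j) = 1)
    \<longleftrightarrow> (\<Sum>i = 1..D. rank (colour_arcs i)) = 2 \<and> (\<Sum>i = 1..D. double_genus (colour_arcs i)) = 0"
    (is "?l \<longleftrightarrow> ?S = 2 \<and> ?G = 0")
proof
  have S: "?S \<le> 2" using sum_colour_rank_le two by simp
  have whole: "double_genus (colour_arcs i) = double_genus (arcs (skel M))"
    if "rank (colour_arcs i) = 2" for i
    using rank_genus_subset[OF opp_closed_arcs opp_closed_colour_arcs, of i] that two
    by (auto simp: circuit_rank_eq)
  \<comment> \<open>Together with \<open>?S \<le> 2\<close> this leaves rank 0 for every colour
    other than the ones named.\<close>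
  have part: "sum (\<lambda>i. rank (colour_arcs i)) J \<le> ?S" if "J \<subseteq> {1..D}" for J
    using that colour_rank_nonneg by (intro sum_mono2) auto
  {
    assume ?l
    then show "?S = 2 \<and> ?G = 0"
    proof (elim disjE conjE bexE)
      fix i assume "planar_map M" and i: "i \<in> {1..D}" "rank (colour_arcs i) = 2"
      have "double_genus (colour_arcs j) = 0" if "j \<in> {1..D}" for j
      proof (cases "j = i")
        case True
        then show ?thesis using whole i(2) \<open>planar_map M\<close> planar_map_iff by simp
      next
        case False
        then have "rank (colour_arcs j) \<le> 1" using part[of "{i, j}"] i that S by simp
        then show ?thesis by (rule colour_genus_eq_0)
      qed
      then show ?thesis using part[of "{i}"] i S by simp
    next
      fix i j assume ij: "i \<in> {1..D}" "j \<in> {1..D}" "i \<noteq> j"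
        "rank (colour_arcs i) = 1" "rank (colour_arcs j) = 1"
      have "double_genus (colour_arcs k) = 0" if "k \<in> {1..D}" for k
      proof (rule colour_genus_eq_0)
        have "rank (colour_arcs k) \<le> 0" if "k \<noteq> i" "k \<noteq> j"
          using part[of "{i, j, k}"] ij \<open>k \<in> {1..D}\<close> that S by simp
        then show "rank (colour_arcs k) \<le> 1" using ij by fastforce
      qed
      then show ?thesis using part[of "{i, j}"] ij S by simp
    qed
  next
    assume r: "?S = 2 \<and> ?G = 0"
    have "double_genus (colour_arcs i) = 0" if "i \<in> {1..D}" for i
      using r that sum_nonneg_eq_0_iff[of "{1..D}" "\<lambda>i. double_genus (colour_arcs i)"]
        colour_genus_nonneg_even by auto
    note zero = this
    from finite_atLeastAtMost colour_rank_nonneg conjunct1[OF r] show ?l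
    proof (cases rule: sum_nonneg_eq_2_cases)
      case (one i)
      have "planar_map M" unfolding planar_map_iff using whole[OF one(2)] zero[OF one(1)] by simp
      then show ?thesis using one by (intro disjI1 conjI bexI[of _ i])
    next
      case (two i j)
      then show ?thesis by (intro disjI2 bexI[of _ i] bexI[of _ j] conjI)
    qed
  }
qed

lemma unique_cycle_iff: "circuit_rank M = 1 \<longleftrightarrow> (\<exists>C. cycles M = {C})"
  using rank_eq_1_iff[OF opp_closed_arcs] by (simp add: circuit_rank_eq cycles_in_arcs)

lemma acyclic_iff: "circuit_rank M = 0 \<longleftrightarrow> cycles M = {}"
  using rank_eq_0_iff[OF opp_closed_arcs] by (simp add: circuit_rank_eq cycles_in_arcs)

lemma monochromatic_cycle_iff:
  "(\<exists>C. cycles M = {C} \<and> monochromatic M C) \<longleftrightarrow>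
    circuit_rank M = 1 \<and> (\<Sum>i = 1..D. rank (colour_arcs i)) = 1"
  unfolding unique_cycle_iff using monochromatic_unique_cycle_iff by blast

lemma polychromatic_cycle_iff:
  "(\<exists>C. cycles M = {C} \<and> polychromatic M C) \<longleftrightarrow>
    circuit_rank M = 1 \<and> (\<Sum>i = 1..D. rank (colour_arcs i)) = 0"
proof -
  have "polychromatic M C \<longleftrightarrow> (\<Sum>i = 1..D. rank (colour_arcs i)) = 0" if C: "cycles M = {C}" for C
  proof -
    have "circuit_rank M = 1" using unique_cycle_iff C by blast
    moreover have "0 \<le> (\<Sum>i = 1..D. rank (colour_arcs i))"
      by (intro sum_nonneg) (rule colour_rank_nonneg)
    moreover have "polychromatic M C \<longleftrightarrow> \<not> monochromatic M C"
      by (rule polychromatic_iff) (simp add: C)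
    ultimately show ?thesis
      using monochromatic_unique_cycle_iff[OF C] sum_colour_rank_le by linarith
  qed
  then show ?thesis unfolding unique_cycle_iff by blast
qed

lemma connectedI_comp_of:
  assumes u: "u \<in> verts (skel M)" and all: "\<And>v. v \<in> verts (skel M) \<Longrightarrow> v \<in> comp_of (arcs (skel M)) u"
  shows "Digraph_Component.connected (skel M)"
proof (rule connectedI)
  show "verts (skel M) \<noteq> {}" using u by blast
  fix v w assume v: "v \<in> verts (skel M)" and w: "w \<in> verts (skel M)"
  have "w \<in> comp_of (arcs (skel M)) v"
    using comp_of_trans[OF comp_of_sym[OF opp_closed_arcs all[OF v]] all[OF w]] .
  then have "reachable (skel M) v w"
    using reachable_submap_skel[OF opp_closed_arcs v] by simp
  then show "reachable (mk_symmetric (skel M)) v w"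
    by (rule reachable_mk_symmetricI)
qed

end

subsection \<open>The first values of the degree\<close>

text \<open>Here \<open>S\<close> stands for the sum of the colour ranks and \<open>G\<close> for
  the sum of the doubled colour genera. Written as (d - 2) L + 2 (L - S) + G, the degree has only
  nonnegative terms, so a bound on \<open>L\<close> from below bounds it from below and finitely
  many cases remain.\<close>

lemma degree_values:
  fixes d L S G \<delta> :: int
  assumes "3 \<le> d" "0 \<le> S" "S \<le> L" "0 \<le> G" "L \<le> 1 \<longrightarrow> G = 0" and \<delta>: "\<delta> = d * L - 2 * S + G"
  shows "0 \<le> \<delta>" "\<delta> = 0 \<longleftrightarrow> L = 0" "0 < \<delta> \<Longrightarrow> d - 2 \<le> \<delta>"
    "\<delta> = d - 2 \<longleftrightarrow> L = 1 \<and> S = 1" "d - 2 < \<delta> \<Longrightarrow> (if d = 3 then 2 else d) \<le> \<delta>"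
    "4 < d \<Longrightarrow> \<delta> = d \<longleftrightarrow> L = 1 \<and> S = 0"
    "d = 4 \<Longrightarrow> \<delta> = 4 \<longleftrightarrow> (L = 1 \<and> S = 0) \<or> (L = 2 \<and> S = 2 \<and> G = 0)"
    "d = 3 \<Longrightarrow> \<delta> = 2 \<longleftrightarrow> L = 2 \<and> S = 2 \<and> G = 0"
proof -
  have "3 * (d - 2) \<le> \<delta>" if "3 \<le> L"
  proof -
    have "3 * (d - 2) \<le> L * (d - 2)" using that assms(1) by (intro mult_right_mono) auto
    also have "\<dots> \<le> \<delta>" using \<delta> assms(3,4) by (simp add: algebra_simps)
    finally show ?thesis .
  qed
  moreover have "0 \<le> L" using assms by linarith
  ultimately consider "L = 0" "S = 0" "\<delta> = 0" | "L = 1" "S = 0" "\<delta> = d" | "L = 1" "S = 1" "\<delta> = d - 2"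
    | "L = 2" "S \<le> 2" "\<delta> = 2 * d - 2 * S + G" | "3 \<le> L" "3 * (d - 2) \<le> \<delta>"
    using assms by (cases "L = 0"; cases "L = 1"; cases "L = 2"; cases "S = 0"; simp; fail)
  note cases = this
  show "0 \<le> \<delta>" "\<delta> = 0 \<longleftrightarrow> L = 0" "0 < \<delta> \<Longrightarrow> d - 2 \<le> \<delta>"
    "\<delta> = d - 2 \<longleftrightarrow> L = 1 \<and> S = 1" "d - 2 < \<delta> \<Longrightarrow> (if d = 3 then 2 else d) \<le> \<delta>"
    "4 < d \<Longrightarrow> \<delta> = d \<longleftrightarrow> L = 1 \<and> S = 0"
    "d = 4 \<Longrightarrow> \<delta> = 4 \<longleftrightarrow> (L = 1 \<and> S = 0) \<or> (L = 2 \<and> S = 2 \<and> G = 0)"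
    "d = 3 \<Longrightarrow> \<delta> = 2 \<longleftrightarrow> L = 2 \<and> S = 2 \<and> G = 0"
    by (cases rule: cases; use assms(1,2,4) in force)+
qed

section \<open>Maps attaining the first values\<close>

definition example_opp :: "nat \<Rightarrow> nat \<Rightarrow> nat" where
  "example_opp k x = (if x < 2 * k then if even x then x + 1 else x - 1 else x)"

text \<open>
  The edges are the pairs \<open>{2 j, 2 j + 1}\<close>, all of different colours, and the half-edges at a
  vertex form a residue class modulo \<open>m\<close>: one vertex gives a bouquet of \<open>k\<close> loops, and
  \<open>m = k = 2\<close> a polychromatic cycle.
\<close>

definition example_map :: "nat \<Rightarrow> nat \<Rightarrow> (nat, nat) cmap" where
  "example_map m k = \<lparr>
     skel = \<lparr>verts = {..<m}, arcs = {..<2 * k}, tail = \<lambda>x. x mod m, head = \<lambda>x. example_opp k x mod m\<rparr>,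
     opp = example_opp k,
     rot = \<lambda>x. if x < 2 * k then (x + m) mod (2 * k) else x,
     colour = \<lambda>x. x div 2 + 1\<rparr>"

lemma example_opp_neq: "x < 2 * k \<longleftrightarrow> example_opp k x \<noteq> x"
  unfolding example_opp_def by presburger

lemma example_opp_opp: "x < 2 * k \<Longrightarrow> example_opp k (example_opp k x) = x"
  unfolding example_opp_def by presburger

lemma example_opp_div: "example_opp k x div 2 = x div 2"
  unfolding example_opp_def by presburger

lemma example_rot_funpow:
  fixes m n x k :: nat
  assumes "x < n"
  shows "((\<lambda>x. if x < n then (x + m) mod n else x) ^^ k) x = (x + k * m) mod n"
proof (induction k)
  case 0 then show ?case using assms by simp
next
  case (Suc k)
  have "(x + k * m) mod n < n" using assms by simp
  then show ?case using Suc by (simp add: mod_add_right_eq algebra_simps)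
qed

text \<open>As \<open>m\<close> divides \<open>2 * k\<close>, adding \<open>m\<close> modulo
  \<open>2 * k\<close> preserves residues modulo \<open>m\<close>, so the rotation stays at its
  vertex; iterated from the least half-edge \<open>v\<close> it runs through the whole residue
  class.\<close>

lemma coloured_map_example:
  assumes m: "0 < m" "m dvd 2 * k" and k: "k \<le> D"
  shows "coloured_map D (example_map m k)"
proof (unfold_locales; (unfold example_map_def cmap.simps pre_digraph.simps)?)
  let ?r = "\<lambda>x. if x < 2 * k then (x + m) mod (2 * k) else x"
  show "finite {..<m}" "finite {..<2 * k}" by simp_all
  fix e
  show "e \<in> {..<2 * k} \<Longrightarrow> e mod m \<in> {..<m}" "e \<in> {..<2 * k} \<Longrightarrow> example_opp k e mod m \<in> {..<m}"
    using m by simp_all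
  show "(e \<in> {..<2 * k}) = (example_opp k e \<noteq> e)" using example_opp_neq by simp
  show "e \<in> {..<2 * k} \<Longrightarrow> example_opp k (example_opp k e) = e" using example_opp_opp by simp
  show "e \<in> {..<2 * k} \<Longrightarrow> e div 2 + 1 \<in> {1..D}" using k by (simp add: less_mult_imp_div_less; linarith?)
  show "example_opp k e div 2 + 1 = e div 2 + 1" by (simp add: example_opp_div)
  show "?r permutes {..<2 * k}"
  proof (rule bij_imp_permutes)
    have "?r ` {..<2 * k} = {..<2 * k}"
    proof (intro equalityI subsetI)
      fix y assume y: "y \<in> {..<2 * k}"
      \<comment> \<open>Adding \<open>(2 * k - 1) * m\<close> amounts to subtracting
        \<open>m\<close> modulo \<open>2 * k\<close>, without truncated subtraction.\<close>
      let ?z = "(y + (2 * k - 1) * m) mod (2 * k)"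
      have "?z < 2 * k" using y by simp
      moreover have "(?z + m) mod (2 * k) = y"
      proof -
        have "(?z + m) mod (2 * k) = (y + ((2 * k - 1) * m + m)) mod (2 * k)"
          by (simp add: mod_add_left_eq add.assoc)
        also have "(2 * k - 1) * m + m = 2 * k * m"
          using y by (cases k) (simp_all add: algebra_simps)
        finally show ?thesis using y by simp
      qed
      ultimately show "y \<in> ?r ` {..<2 * k}" by (intro image_eqI[of _ _ ?z]) simp_all
    qed auto
    then show "bij_betw ?r {..<2 * k} {..<2 * k}"
      by (simp add: bij_betw_def finite_surj_inj eq_card_imp_inj_on)
    show "?r x = x" if "x \<notin> {..<2 * k}" for x using that by simp
  qed
  fix v
  let ?O = "out_arcs \<lparr>verts = {..<m}, arcs = {..<2 * k}, tail = \<lambda>x. x mod m, head = \<lambda>x. example_opp k x mod m\<rparr> v"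
  assume v: "v \<in> {..<m}" and "?O \<noteq> {}"
  have O: "?O = {x. x < 2 * k \<and> x mod m = v}" by (auto simp: out_arcs_def)
  obtain x where "x \<in> ?O" using \<open>?O \<noteq> {}\<close> by blast
  then have k0: "0 < k" by simp
  then have mk: "m \<le> 2 * k" using m by (intro dvd_imp_le) simp_all
  then have v2: "v < 2 * k" using v by simp
  show "cyclic_on ?r ?O"
  proof (rule cyclic_on_singleI)
    show "v \<in> ?O" using v v2 O by simp
    have pow: "(?r ^^ n) v = (v + n * m) mod (2 * k)" for n by (rule example_rot_funpow[OF v2])
    show "?O = orbit ?r v"
    proof (intro equalityI subsetI)
      fix x assume "x \<in> ?O"
      then have x: "x < 2 * k" "x mod m = v" using O by simp_all
      \<comment> \<open>The additional \<open>2 * k\<close> steps go round back to the same point;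
        they make the exponent positive, as membership in \<open>orbit\<close> requires, also when
        \<open>x = v\<close>.\<close>
      have "v + (x div m + 2 * k) * m = x + 2 * k * m"
        using x(2) by (simp add: algebra_simps) (metis mod_mult_div_eq mult.commute)
      then have "(?r ^^ (x div m + 2 * k)) v = x" unfolding pow using x(1) by simp
      then show "x \<in> orbit ?r v" unfolding orbit_altdef using k0
        by (intro CollectI exI[of _ "x div m + 2 * k"]) simp
    next
      fix x assume "x \<in> orbit ?r v"
      then obtain n where "x = (v + n * m) mod (2 * k)" unfolding orbit_altdef pow by blast
      then show "x \<in> ?O" using O k0 v m by (simp add: mod_mod_cancel)
    qed
  qed
qed (simp_all)

lemma example_map_simps:
  "verts (skel (example_map m k)) = {..<m}" "arcs (skel (example_map m k)) = {..<2 * k}"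
  "tail (skel (example_map m k)) x = x mod m" "head (skel (example_map m k)) x = example_opp k x mod m"
  "opp (example_map m k) = example_opp k" "colour (example_map m k) x = x div 2 + 1"
  by (simp_all add: example_map_def)

lemma edge_of_example:
  assumes "x < 2 * k"
  shows "edge_of (example_map m k) x = {2 * (x div 2), 2 * (x div 2) + 1}"
proof (cases "even x")
  case True then show ?thesis using assms by (simp add: edge_of_def example_map_simps example_opp_def)
next
  case False
  then have "x - 1 = 2 * (x div 2)" "x = 2 * (x div 2) + 1" by presburger+
  moreover have "edge_of (example_map m k) x = {x, x - 1}"
    using False assms by (simp add: edge_of_def example_map_simps example_opp_def)
  ultimately show ?thesis by (metis insert_commute)
qed

lemma num_edges_example: "num_edges (example_map m k) = k"
proof -
  have "edge_of (example_map m k) ` {..<2 * k} = (\<lambda>j. {2 * j, 2 * j + 1}) ` {..<k}"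
  proof (intro equalityI subsetI)
    fix e assume "e \<in> edge_of (example_map m k) ` {..<2 * k}"
    then obtain x where "x < 2 * k" "e = edge_of (example_map m k) x" by blast
    then show "e \<in> (\<lambda>j. {2 * j, 2 * j + 1}) ` {..<k}"
      using edge_of_example by (intro image_eqI[of _ _ "x div 2"]) auto
  next
    fix e assume "e \<in> (\<lambda>j. {2 * j, 2 * j + 1}) ` {..<k}"
    then obtain j where "j < k" "e = {2 * j, 2 * j + 1}" by blast
    then show "e \<in> edge_of (example_map m k) ` {..<2 * k}"
      using edge_of_example[of "2 * j" k m] by (intro image_eqI[of _ _ "2 * j"]) auto
  qed
  moreover have "inj_on (\<lambda>j::nat. {2 * j, 2 * j + 1}) {..<k}"
    by (rule inj_onI) (auto simp: doubleton_eq_iff)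
  ultimately show ?thesis by (simp add: num_edges_def example_map_simps card_image)
qed

text \<open>With a single vertex the rank is the number of edges. Each colour has at most one loop,
  hence genus 0, and the colour ranks add up to the circuit rank \<open>k\<close>, which leaves
  \<open>D k - 2 k\<close>.\<close>

lemma bouquet_degree:
  assumes "k \<le> D"
  shows "connected_coloured_map D (example_map (Suc 0) k) \<and>
    map_degree D (example_map (Suc 0) k) = (int D - 2) * int k"
proof -
  let ?M = "example_map (Suc 0) k"
  interpret coloured_map D ?M by (rule coloured_map_example) (use assms in simp_all)
  have verts: "verts (skel ?M) = {0}" by (auto simp: example_map_simps)
  have conn: "Digraph_Component.connected (skel ?M)"
    by (rule connectedI_comp_of[of 0]) (auto simp: verts comp_of_self)
  have rank: "rank H = int (edges H)" for H
    by (simp add: rank_def comps_def verts)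
  have "edges (colour_arcs i) \<le> 1" for i
  proof -
    have "edge_of ?M ` colour_arcs i \<subseteq> {{2 * (i - 1), 2 * (i - 1) + 1}}"
      using edge_of_example[of _ k "Suc 0"] by (auto simp: example_map_simps)
    then have "card (edge_of ?M ` colour_arcs i) \<le> card {{2 * (i - 1), 2 * (i - 1) + 1}}"
      by (intro card_mono) simp_all
    then show ?thesis by (simp add: edges_def)
  qed
  then have "double_genus (colour_arcs i) = 0" for i
    by (intro colour_genus_eq_0) (simp add: rank)
  moreover have "(\<Sum>i = 1..D. rank (colour_arcs i)) = int k"
    unfolding rank of_nat_sum[symmetric] sum_edges_colours num_edges_eq[symmetric] num_edges_example ..
  moreover have "circuit_rank ?M = int k"
    using num_edges_eq num_edges_example[of "Suc 0" k] by (simp add: circuit_rank_eq rank)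
  ultimately have "map_degree D ?M = (int D - 2) * int k"
    using map_degree_eq[OF conn] by (simp add: algebra_simps)
  then show ?thesis using conn coloured_map_axioms by (simp add: connected_coloured_map_def)
qed

text \<open>Two parallel edges of different colours between the vertices 0 and 1: the circuit rank
  is 1, but a single edge that is not a loop has rank 0, so nothing is subtracted from D.\<close>

lemma two_coloured_cycle_degree:
  assumes "2 \<le> D"
  shows "connected_coloured_map D (example_map 2 2) \<and> map_degree D (example_map 2 2) = int D"
proof -
  let ?M = "example_map 2 2"
  interpret coloured_map D ?M by (rule coloured_map_example) (use assms in simp_all)
  have verts: "verts (skel ?M) = {0, 1}" by (auto simp: example_map_simps)
  have loopfree: "head (skel ?M) a \<noteq> tail (skel ?M) a" if "a \<in> arcs (skel ?M)" for a
    using that unfolding example_map_simps example_opp_def by simp presburger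
  have "1 \<in> comp_of (arcs (skel ?M)) 0"
    using head_in_comp_of[of 0 "arcs (skel ?M)" 0] comp_of_self[of 0]
    by (simp add: example_map_simps example_opp_def)
  then have conn: "Digraph_Component.connected (skel ?M)"
    by (intro connectedI_comp_of[of 0]) (auto simp: verts comp_of_self)
  have "circuit_rank ?M = 1"
    using num_edges_example[of 2 2] comps_connected[OF conn]
    by (simp add: circuit_rank_def num_comps_eq num_verts_def verts)
  moreover have zero: "rank (colour_arcs i) = 0" for i
  proof (cases "colour_arcs i = {}")
    case True then show ?thesis by (simp only: rank_empty)
  next
    case False
    then obtain a where a: "a \<in> colour_arcs i" by blast
    have "x \<in> {a, opp ?M a}" if "x \<in> colour_arcs i" for x
    proof -
      have "x < 4" "a < 4" "x div 2 = a div 2" using a that by (auto simp: example_map_simps)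
      then show ?thesis unfolding example_map_simps example_opp_def by simp presburger
    qed
    then have empty: "colour_arcs i - {a, opp ?M a} = {}" by blast
    have "head (skel ?M) a \<notin> comp_of {} (tail (skel ?M) a)"
      using loopfree[of a] a by (simp add: comp_of_def ends_def)
    then show ?thesis
      using rank_delete[OF opp_closed_colour_arcs a] unfolding empty rank_empty by simp
  qed
  moreover have "double_genus (colour_arcs i) = 0" for i
    by (rule colour_genus_eq_0) (simp add: zero)
  ultimately have "map_degree D ?M = int D" using map_degree_eq[OF conn] by simp
  then show ?thesis using conn coloured_map_axioms by (simp add: connected_coloured_map_def)
qed

theorem corollary2p4p1:
  fixes D :: nat
  assumes "D \<ge> 3"
  shows
    "(\<forall>M :: ('v, 'h) cmap. connected_coloured_map D M \<longrightarrow>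
        map_degree D M \<ge> 0
      \<and> (circuit_rank M = 1 \<longleftrightarrow> (\<exists>C. cycles M = {C}))
      \<and> (map_degree D M = 0 \<longleftrightarrow> is_tree M)
      \<and> (map_degree D M > 0 \<longrightarrow> map_degree D M \<ge> int D - 2)
      \<and> (map_degree D M = int D - 2 \<longleftrightarrow> (\<exists>C. cycles M = {C} \<and> monochromatic M C))
      \<and> (map_degree D M > int D - 2 \<longrightarrow> map_degree D M \<ge> (if D = 3 then 2 else int D))
      \<and> (D > 4 \<longrightarrow>
          (map_degree D M = int D \<longleftrightarrow> (\<exists>C. cycles M = {C} \<and> polychromatic M C)))
      \<and> (D = 4 \<longrightarrow>
          (map_degree D M = 4 \<longleftrightarrow>
             (\<exists>C. cycles M = {C} \<and> polychromatic M C)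
           \<or> (planar_map M \<and> circuit_rank M = 2 \<and>
              (\<exists>i\<in>{1..D}. circuit_rank (colour_submap M i) = 2))
           \<or> (circuit_rank M = 2 \<and>
              (\<exists>i\<in>{1..D}. \<exists>j\<in>{1..D}. i \<noteq> j \<and>
                 circuit_rank (colour_submap M i) = 1 \<and>
                 circuit_rank (colour_submap M j) = 1))))
      \<and> (D = 3 \<longrightarrow>
          (map_degree D M = 2 \<longleftrightarrow>
             (planar_map M \<and> circuit_rank M = 2 \<and>
              (\<exists>i\<in>{1..D}. circuit_rank (colour_submap M i) = 2))
           \<or> (circuit_rank M = 2 \<and>
              (\<exists>i\<in>{1..D}. \<exists>j\<in>{1..D}. i \<noteq> j \<and>
                 circuit_rank (colour_submap M i) = 1 \<and>
                 circuit_rank (colour_submap M j) = 1)))))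
   \<and> (\<forall>d \<in> {0, int D - 2, (if D = 3 then 2 else int D)}.
        \<exists>M :: (nat, nat) cmap. connected_coloured_map D M \<and> map_degree D M = d)"
proof (intro conjI allI impI)
  fix M :: "('v, 'h) cmap"
  assume "connected_coloured_map D M"
  then have cm: "coloured_map D M" and conn: "Digraph_Component.connected (skel M)"
    by (simp_all add: connected_coloured_map_def)
  interpret coloured_map D M by (rule cm)
  let ?L = "circuit_rank M" and ?S = "\<Sum>i = 1..D. rank (colour_arcs i)"
    and ?G = "\<Sum>i = 1..D. double_genus (colour_arcs i)"
  have S0: "0 \<le> ?S" by (intro sum_nonneg) (rule colour_rank_nonneg)
  have G0: "0 \<le> ?G" using colour_genus_nonneg_even by (intro sum_nonneg) blast
  \<comment> \<open>Each colour rank is bounded by the sum of all of them, hence by the circuit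
    rank.\<close>
  have G1: "?L \<le> 1 \<longrightarrow> ?G = 0"
  proof (intro impI sum.neutral ballI colour_genus_eq_0)
    fix i assume "?L \<le> 1" "i \<in> {1..D}"
    then have "rank (colour_arcs i) \<le> ?S" using colour_rank_nonneg by (intro member_le_sum) simp_all
    then show "rank (colour_arcs i) \<le> 1" using sum_colour_rank_le \<open>?L \<le> 1\<close> by linarith
  qed
  have "3 \<le> int D" using assms by simp
  note degree = degree_values[OF this S0 sum_colour_rank_le G0 G1 map_degree_eq[OF conn]]
  have types: "(planar_map M \<and> ?L = 2 \<and> (\<exists>i\<in>{1..D}. circuit_rank (colour_submap M i) = 2)) \<or>
      (?L = 2 \<and> (\<exists>i\<in>{1..D}. \<exists>j\<in>{1..D}. i \<noteq> j \<and>
        circuit_rank (colour_submap M i) = 1 \<and> circuit_rank (colour_submap M j) = 1))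
    \<longleftrightarrow> ?L = 2 \<and> ?S = 2 \<and> ?G = 0"
    unfolding circuit_rank_colour_submap using two_cycle_types by (cases "?L = 2") simp_all
  show "0 \<le> map_degree D M" by (rule degree(1))
  show "circuit_rank M = 1 \<longleftrightarrow> (\<exists>C. cycles M = {C})" by (rule unique_cycle_iff)
  show "map_degree D M = 0 \<longleftrightarrow> is_tree M" using degree(2) acyclic_iff conn by (simp add: is_tree_def)
  show "int D - 2 \<le> map_degree D M" if "0 < map_degree D M" using that by (rule degree(3))
  show "map_degree D M = int D - 2 \<longleftrightarrow> (\<exists>C. cycles M = {C} \<and> monochromatic M C)"
    unfolding monochromatic_cycle_iff by (rule degree(4))
  show "(if D = 3 then 2 else int D) \<le> map_degree D M" if "int D - 2 < map_degree D M"
    using degree(5)[OF that] by (simp split: if_splits)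
  show "map_degree D M = int D \<longleftrightarrow> (\<exists>C. cycles M = {C} \<and> polychromatic M C)" if "4 < D"
    unfolding polychromatic_cycle_iff using that by (intro degree(6)) simp
  show "map_degree D M = 4 \<longleftrightarrow>
             (\<exists>C. cycles M = {C} \<and> polychromatic M C)
           \<or> (planar_map M \<and> circuit_rank M = 2 \<and>
              (\<exists>i\<in>{1..D}. circuit_rank (colour_submap M i) = 2))
           \<or> (circuit_rank M = 2 \<and>
              (\<exists>i\<in>{1..D}. \<exists>j\<in>{1..D}. i \<noteq> j \<and>
                 circuit_rank (colour_submap M i) = 1 \<and>
                 circuit_rank (colour_submap M j) = 1))" if "D = 4"
    unfolding polychromatic_cycle_iff types using that by (intro degree(7)) simp
  show "map_degree D M = 2 \<longleftrightarrow>
             (planar_map M \<and> circuit_rank M = 2 \<and>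
              (\<exists>i\<in>{1..D}. circuit_rank (colour_submap M i) = 2))
           \<or> (circuit_rank M = 2 \<and>
              (\<exists>i\<in>{1..D}. \<exists>j\<in>{1..D}. i \<noteq> j \<and>
                 circuit_rank (colour_submap M i) = 1 \<and>
                 circuit_rank (colour_submap M j) = 1))" if "D = 3"
    unfolding types using that by (intro degree(8)) simp
next
  have D: "0 \<le> D" "1 \<le> D" "2 \<le> D" using assms by simp_all
  \<comment> \<open>Bouquets of 0, 1 and 2 loops have degrees 0, D - 2 and 2 D - 4, the last being 2
    for D = 3; otherwise the two-coloured cycle gives D. The examples live on \<open>nat\<close>,
    since arbitrary types may have too few elements to hold them.\<close>
  show "\<forall>d \<in> {0, int D - 2, (if D = 3 then 2 else int D)}.
        \<exists>M :: (nat, nat) cmap. connected_coloured_map D M \<and> map_degree D M = d"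
    using bouquet_degree[OF D(1)] bouquet_degree[OF D(2)] bouquet_degree[OF D(3)]
      two_coloured_cycle_degree[OF D(3)] by (cases "D = 3") force+
qed

end
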